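(* Let $G$ be a simple connected bipartite graph on $n$ vertices with Laplacian matrix $L_G$. Then for every partition $\lambda\vdash n$ and every $0\le r\le n$, the coefficient $b_{\lambda,r}(L_G)$ is a non-negative integer. Moreover, the generalized graph shift operation decreases each of these coefficients: if $G_1$ and $G_2$ are simple connected bipartite graphs on $n$ vertices such that $G_2=\mathrm{GGS}(G_1)$ (that is, $G_2$ is obtained from $G_1$ by one generalized graph shift), then $b_{\lambda,r}(L_{G_2})\le b_{\lambda,r}(L_{G_1})$ for all $\lambda\vdash n$ and all $0\le r\le n$.
   Context: For $\lambda\vdash n$, $\chi_\lambda$ is the irreducible complex character of the symmetric group $\mathfrak{S}_n$ indexed by $\lambda$. The immanant of a complex $n\times n$ matrix $A=(a_{i,j})$ is $\mathrm{imm}_\lambda(A)=\sum_{\psi\in\mathfrak{S}_n}\chi_\lambda(\psi)\prod_{i=1}^n a_{i,\psi(i)}$. The Laplacian matrix of a graph $G$ on vertex set $[n]=\{1,\dots,n\}$ is $L_G=D-A(G)$, with $D$ the diagonal matrix of degrees and $A(G)$ the adjacency matrix. The coefficients $b_{\lambda,r}(L_G)$ are defined by $\mathrm{imm}_\lambda(xI-L_G)=\sum_{r=0}^n(-1)^r b_{\lambda,r}(L_G)x^{n-r}$. Generalized graph shift (GGS): let $G_1$ be a graph and let $u$ (the recipient) and $w$ (the donor) be two distinct vertices of $G_1$ connected by a path $P$ from $u$ to $w$ such that (1) every interior vertex of $P$ (if any) has degree 2 in $G_1$, and (2) $u$ and $w$ are not both contained in one cycle of $G_1$. Let $w'$ be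 the neighbour of $w$ on $P$. Then $G_2=\mathrm{GGS}(G_1)$ is the graph obtained from $G_1$ by moving all neighbours of $w$ except $w'$ to $u$, i.e. for each neighbour $z\ne w'$ of $w$, the edge $\{w,z\}$ is deleted and the edge $\{u,z\}$ is added. *)

theory Defs
  imports
    Complex_Main
    "HOL-Library.Function_Algebras"
    "HOL-Library.Complex_Order"
    "HOL-Combinatorics.Permutations"
    "HOL-Computational_Algebra.Polynomial"
    "Jordan_Normal_Form.Matrix"
    "Graph_Theory.Graph_Theory"
begin

section \<open>Irreducible characters of the symmetric group\<close>

definition partition_of :: "nat list \<Rightarrow> nat \<Rightarrow> bool" where
  "partition_of lam n \<longleftrightarrow> sorted_wrt (\<ge>) lam \<and> 0 \<notin> set lam \<and> sum_list lam = n"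

definition fscale :: "complex \<Rightarrow> ('a \<Rightarrow> complex) \<Rightarrow> 'a \<Rightarrow> complex" where
  "fscale c f = (\<lambda>x. c * f x)"

global_interpretation fun_vs: vector_space "fscale :: complex \<Rightarrow> ('a \<Rightarrow> complex) \<Rightarrow> 'a \<Rightarrow> complex"
  by unfold_locales (auto simp: fscale_def algebra_simps fun_eq_iff)

text \<open>The trace of an operator on a finite-dimensional invariant subspace \<open>W\<close>, computed in an
  arbitrary basis of \<open>W\<close>; by \<open>trace_on_eq\<close> below the choice is immaterial.\<close>

definition trace_on :: "('a \<Rightarrow> complex) set \<Rightarrow> (('a \<Rightarrow> complex) \<Rightarrow> ('a \<Rightarrow> complex)) \<Rightarrow> complex" where
  "trace_on W T =
     (let B = (SOME B. fun_vs.independent B \<and> fun_vs.span B = W)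
      in \<Sum>b\<in>B. fun_vs.representation B (T b) b)"

lemma trace_on_eq:
  assumes lin: "Vector_Spaces.linear fscale fscale T"
    and inv: "T ` W \<subseteq> W"
    and B: "finite B" "fun_vs.independent B" "fun_vs.span B = W"
  shows "trace_on W T = (\<Sum>b\<in>B. fun_vs.representation B (T b) b)"
proof -
  interpret T: Vector_Spaces.linear fscale fscale T by (rule lin)
  define C where "C = (SOME C. fun_vs.independent C \<and> fun_vs.span C = W)"
  have C: "fun_vs.independent C" "fun_vs.span C = W"
    using someI[of "\<lambda>C. fun_vs.independent C \<and> fun_vs.span C = W" B] B
    unfolding C_def by auto
  have "C \<subseteq> fun_vs.span B" using C B fun_vs.span_superset by metis
  hence fC: "finite C" using fun_vs.independent_span_bound[OF B(1) C(1)] by blast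
  let ?rB = "fun_vs.representation B" and ?rC = "fun_vs.representation C"
  have inW: "b \<in> B \<Longrightarrow> b \<in> W" "b \<in> C \<Longrightarrow> b \<in> W" for b
    using B(3) C(2) fun_vs.span_base by metis+
  have TW: "x \<in> W \<Longrightarrow> T x \<in> W" for x using inv by auto
  have expB: "x \<in> W \<Longrightarrow> (\<Sum>b\<in>B. fscale (?rB x b) b) = x" for x
    using fun_vs.sum_representation_eq[OF B(2) _ B(1) order_refl] B(3) by auto
  have expC: "x \<in> W \<Longrightarrow> (\<Sum>c\<in>C. fscale (?rC x c) c) = x" for x
    using fun_vs.sum_representation_eq[OF C(1) _ fC order_refl] C(2) by auto
  have spanW: "fun_vs.subspace W" using B(3) fun_vs.subspace_span by metis
  have scW: "x \<in> W \<Longrightarrow> fscale k x \<in> W" for k x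
    using spanW by (rule fun_vs.subspace_scale)
  have change: "?rC x c = (\<Sum>b\<in>B. ?rB x b * ?rC b c)" if "x \<in> W" for x c
  proof -
    have "?rC x c = ?rC (\<Sum>b\<in>B. fscale (?rB x b) b) c" using expB that by simp
    also have "\<dots> = (\<Sum>b\<in>B. ?rC (fscale (?rB x b) b) c)"
      by (subst fun_vs.representation_sum[OF C(1)])
         (simp_all add: C(2) scW inW)
    also have "\<dots> = (\<Sum>b\<in>B. ?rB x b * ?rC b c)"
      by (intro sum.cong refl, subst fun_vs.representation_scale[OF C(1)])
         (use C(2) inW in auto)
    finally show ?thesis .
  qed
  have TrB: "?rB (T b) b = (\<Sum>c\<in>C. ?rC b c * ?rB (T c) b)" if "b \<in> B" for b
  proof -
    have "T b = T (\<Sum>c\<in>C. fscale (?rC b c) c)" using expC inW that by simp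
    also have "\<dots> = (\<Sum>c\<in>C. fscale (?rC b c) (T c))" by (simp add: T.sum T.scale)
    finally have "?rB (T b) b = ?rB (\<Sum>c\<in>C. fscale (?rC b c) (T c)) b" by simp
    also have "\<dots> = (\<Sum>c\<in>C. ?rB (fscale (?rC b c) (T c)) b)"
      by (subst fun_vs.representation_sum[OF B(2)])
         (simp_all add: B(3) scW inW TW)
    also have "\<dots> = (\<Sum>c\<in>C. ?rC b c * ?rB (T c) b)"
      by (intro sum.cong refl, subst fun_vs.representation_scale[OF B(2)])
         (use B(3) inW TW in auto)
    finally show ?thesis .
  qed
  have "trace_on W T = (\<Sum>c\<in>C. ?rC (T c) c)"
    unfolding trace_on_def C_def Let_def ..
  also have "\<dots> = (\<Sum>c\<in>C. \<Sum>b\<in>B. ?rB (T c) b * ?rC b c)"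
    by (intro sum.cong refl change TW inW)
  also have "\<dots> = (\<Sum>b\<in>B. \<Sum>c\<in>C. ?rC b c * ?rB (T c) b)"
    by (subst sum.swap) (simp add: mult.commute)
  also have "\<dots> = (\<Sum>b\<in>B. ?rB (T b) b)"
    by (intro sum.cong refl TrB[symmetric])
  finally show ?thesis .
qed

text \<open>\<open>tab_row\<close> and \<open>tab_col\<close> give the position of an entry \<open>k < sum_list lam\<close> in the Young tableau
  of shape \<open>lam\<close> that is filled with \<open>0, 1, 2, \<dots>\<close> row by row.\<close>

definition tab_row :: "nat list \<Rightarrow> nat \<Rightarrow> nat" where
  "tab_row lam k = (LEAST i. k < sum_list (take (Suc i) lam))"

definition tab_col :: "nat list \<Rightarrow> nat \<Rightarrow> nat" where
  "tab_col lam k = k - sum_list (take (tab_row lam k) lam)"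

definition row_group :: "nat list \<Rightarrow> (nat \<Rightarrow> nat) set" where
  "row_group lam = {p. p permutes {0..<sum_list lam} \<and>
     (\<forall>k<sum_list lam. tab_row lam (p k) = tab_row lam k)}"

definition col_group :: "nat list \<Rightarrow> (nat \<Rightarrow> nat) set" where
  "col_group lam = {p. p permutes {0..<sum_list lam} \<and>
     (\<forall>k<sum_list lam. tab_col lam (p k) = tab_col lam k)}"

text \<open>Elements of the group algebra of the symmetric group on \<open>{0..<n}\<close> are functions
  \<open>(nat \<Rightarrow> nat) \<Rightarrow> complex\<close> vanishing off the permutations of \<open>{0..<n}\<close>.  The Young symmetrizer is
  \<open>\<Sum>p\<in>row_group lam. \<Sum>q\<in>col_group lam. sign q \<cdot> (p \<circ> q)\<close>.\<close>

definition young_symmetrizer :: "nat list \<Rightarrow> (nat \<Rightarrow> nat) \<Rightarrow> complex" where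
  "young_symmetrizer lam =
     (\<lambda>s. \<Sum>p\<in>row_group lam. \<Sum>q\<in>col_group lam. if s = p \<circ> q then of_int (sign q) else 0)"

text \<open>Left multiplication by the group element \<open>g\<close>.\<close>

definition left_mult :: "(nat \<Rightarrow> nat) \<Rightarrow> ((nat \<Rightarrow> nat) \<Rightarrow> complex) \<Rightarrow> (nat \<Rightarrow> nat) \<Rightarrow> complex" where
  "left_mult g f = (\<lambda>s. f (inv_into UNIV g \<circ> s))"

text \<open>The irreducible (Specht) module of \<open>lam\<close>, as the left ideal of the group algebra generated by
  the Young symmetrizer.  With this convention the one-row shape gives the trivial module and the
  one-column shape the sign module.\<close>

definition specht_module :: "nat list \<Rightarrow> ((nat \<Rightarrow> nat) \<Rightarrow> complex) set" where
  "specht_module lam =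
     fun_vs.span ((\<lambda>g. left_mult g (young_symmetrizer lam)) ` {g. g permutes {0..<sum_list lam}})"

definition irr_char :: "nat list \<Rightarrow> (nat \<Rightarrow> nat) \<Rightarrow> complex" where
  "irr_char lam g = trace_on (specht_module lam) (left_mult g)"

section \<open>Immanants\<close>

definition immanant :: "nat list \<Rightarrow> complex mat \<Rightarrow> complex" where
  "immanant lam A = (\<Sum>p | p permutes {0..<dim_row A}.
     irr_char lam p * (\<Prod>i = 0..<dim_row A. A $$ (i, p i)))"

definition immanantal_poly :: "nat list \<Rightarrow> complex mat \<Rightarrow> complex poly" where
  "immanantal_poly lam A =
     (THE P. \<forall>x. poly P x = immanant lam (x \<cdot>\<^sub>m 1\<^sub>m (dim_row A) - A))"

text \<open>The coefficients \<open>b\<^sub>\<lambda>\<^sub>,\<^sub>r\<close>; their defining expansion is \<open>immanant_expansion\<close> below.  They are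
  complex numbers; \<open>x \<le> y\<close> on complex numbers is \<open>Re x \<le> Re y \<and> Im x = Im y\<close>.\<close>

definition imm_coeff :: "nat list \<Rightarrow> complex mat \<Rightarrow> nat \<Rightarrow> complex" where
  "imm_coeff lam A r = (-1) ^ r * coeff (immanantal_poly lam A) (dim_row A - r)"

lemma ex_immanantal_poly:
  fixes A :: "complex mat"
  assumes A: "A \<in> carrier_mat n n"
  shows "\<exists>P. degree P \<le> n \<and> (\<forall>x. poly P x = immanant lam (x \<cdot>\<^sub>m 1\<^sub>m n - A))"
proof -
  define e where "e p i = (if p i = i then [:- (A $$ (i, i)), 1:] else [:- (A $$ (i, p i)):])"
    for p and i :: nat
  define P where "P = (\<Sum>p | p permutes {0..<n}. Polynomial.smult (irr_char lam p) (\<Prod>i = 0..<n. e p i))"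
  have "degree (\<Prod>i = 0..<n. e p i) \<le> n" for p
  proof -
    have "degree (\<Prod>i = 0..<n. e p i) \<le> (\<Sum>i = 0..<n. degree (e p i))"
      using degree_prod_sum_le[of "{0..<n}" "e p"] by (simp add: o_def)
    also have "\<dots> \<le> (\<Sum>i = 0..<n. 1)" by (intro sum_mono) (auto simp: e_def)
    finally show ?thesis by simp
  qed
  hence "degree P \<le> n"
    unfolding P_def by (intro degree_sum_le) (auto simp: finite_permutations degree_smult_eq)
  moreover have "poly P x = immanant lam (x \<cdot>\<^sub>m 1\<^sub>m n - A)" for x
  proof -
    have "(\<Prod>i = 0..<n. poly (e p i) x) = (\<Prod>i = 0..<n. (x \<cdot>\<^sub>m 1\<^sub>m n - A) $$ (i, p i))"
      if "p permutes {0..<n}" for p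
    proof (intro prod.cong refl)
      fix i assume "i \<in> {0..<n}"
      moreover from this have "p i < n" using permutes_in_image[OF that, of i] by simp
      ultimately show "poly (e p i) x = (x \<cdot>\<^sub>m 1\<^sub>m n - A) $$ (i, p i)"
        using A by (auto simp: e_def)
    qed
    thus ?thesis using A by (auto simp: P_def immanant_def poly_sum poly_prod intro!: sum.cong)
  qed
  ultimately show ?thesis by blast
qed

lemma immanant_expansion:
  assumes A: "A \<in> carrier_mat n n"
  shows "immanant lam (x \<cdot>\<^sub>m 1\<^sub>m n - A) = (\<Sum>r = 0..n. (-1) ^ r * imm_coeff lam A r * x ^ (n - r))"
proof -
  obtain P where P: "degree P \<le> n" "\<And>x. poly P x = immanant lam (x \<cdot>\<^sub>m 1\<^sub>m n - A)"
    using ex_immanantal_poly[OF A] by blast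
  have eq: "immanantal_poly lam A = P"
    unfolding immanantal_poly_def
  proof (rule the_equality)
    show "\<forall>x. poly P x = immanant lam (x \<cdot>\<^sub>m 1\<^sub>m (dim_row A) - A)" using P A by auto
  next
    fix Q assume "\<forall>x. poly Q x = immanant lam (x \<cdot>\<^sub>m 1\<^sub>m (dim_row A) - A)"
    hence "poly Q = poly P" using P A by auto
    thus "Q = P" by (simp add: poly_eq_poly_eq_iff)
  qed
  have "immanant lam (x \<cdot>\<^sub>m 1\<^sub>m n - A) = (\<Sum>k\<le>n. coeff P k * x ^ k)"
    unfolding P(2)[symmetric] poly_altdef using P(1)
    by (intro sum.mono_neutral_left) (auto simp: coeff_eq_0)
  also have "\<dots> = (\<Sum>r\<le>n. coeff P (n - r) * x ^ (n - r))"
    by (rule sum.reindex_bij_witness[of _ "\<lambda>r. n - r" "\<lambda>r. n - r"]) auto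
  also have "\<dots> = (\<Sum>r = 0..n. (-1) ^ r * imm_coeff lam A r * x ^ (n - r))"
    using A by (intro sum.cong) (auto simp: imm_coeff_def eq atMost_atLeast0 simp flip: power_add mult.assoc)
  finally show ?thesis .
qed

section \<open>Graphs, Laplacian matrices and the generalized graph shift\<close>

text \<open>Simple graphs are symmetric loop-free digraphs without parallel arcs (\<open>pair_graph\<close>), so the
  degree of a vertex is its out-degree.\<close>

definition bipartite :: "'a pair_pre_digraph \<Rightarrow> bool" where
  "bipartite G \<longleftrightarrow> (\<exists>X. \<forall>(u, v) \<in> parcs G. u \<in> X \<longleftrightarrow> v \<notin> X)"

definition degree_mat :: "nat \<Rightarrow> nat pair_pre_digraph \<Rightarrow> complex mat" where
  "degree_mat n G = mat n n (\<lambda>(i, j). if i = j then of_nat (out_degree (with_proj G) i) else 0)"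

definition adjacency_mat :: "nat \<Rightarrow> nat pair_pre_digraph \<Rightarrow> complex mat" where
  "adjacency_mat n G = mat n n (\<lambda>(i, j). if (i, j) \<in> parcs G then 1 else 0)"

definition laplacian :: "nat \<Rightarrow> nat pair_pre_digraph \<Rightarrow> complex mat" where
  "laplacian n G = degree_mat n G - adjacency_mat n G"

text \<open>The library notion \<open>cycle\<close> is directed and also admits the closed walks \<open>a, b, a\<close> along a single
  undirected edge; these are excluded by the length condition.\<close>

definition graph_cycle :: "'a pair_pre_digraph \<Rightarrow> ('a \<times> 'a) awalk \<Rightarrow> bool" where
  "graph_cycle G c \<longleftrightarrow> pre_digraph.cycle (with_proj G) c \<and> length c \<ge> 3"

text \<open>All neighbours of \<open>w\<close> except \<open>w'\<close> are moved to \<open>u\<close>.\<close>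

definition move_neighbours ::
  "'a pair_pre_digraph \<Rightarrow> 'a \<Rightarrow> 'a \<Rightarrow> 'a \<Rightarrow> 'a pair_pre_digraph" where
  "move_neighbours G u w w' =
     (let Z = {z. (w, z) \<in> parcs G \<and> z \<noteq> w'}
      in \<lparr> pverts = pverts G,
           parcs = (parcs G - ({w} \<times> Z \<union> Z \<times> {w})) \<union> ({u} \<times> Z \<union> Z \<times> {u}) \<rparr>)"

text \<open>\<open>ggs G1 G2\<close>: one shift with recipient \<open>u\<close>, donor \<open>w\<close> and path \<open>P\<close> (a list of arcs from \<open>u\<close>
  to \<open>w\<close>) turns \<open>G1\<close> into \<open>G2\<close>.  The last arc of \<open>P\<close> is \<open>(w', w)\<close>.\<close>

definition ggs :: "'a pair_pre_digraph \<Rightarrow> 'a pair_pre_digraph \<Rightarrow> bool" where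
  "ggs G1 G2 \<longleftrightarrow> (\<exists>u w P.
     u \<noteq> w \<and>
     pre_digraph.apath (with_proj G1) u P w \<and>
     (\<forall>x \<in> set (pawalk_verts u P) - {u, w}. out_degree (with_proj G1) x = 2) \<and>
     \<not> (\<exists>c. graph_cycle G1 c \<and> u \<in> fst ` set c \<and> w \<in> fst ` set c) \<and>
     G2 = move_neighbours G1 u w (fst (last P)))"

definition connected_bipartite_graph :: "nat \<Rightarrow> nat pair_pre_digraph \<Rightarrow> bool" where
  "connected_bipartite_graph n G \<longleftrightarrow>
     pair_graph G \<and> pverts G = {0..<n} \<and> connected (with_proj G) \<and> bipartite G"

end

theory Submission
  imports Defs
begin

text \<open>Write the degree of a vertex on the diagonal of \<open>L\<close> as a sum of ones, one for each neighbour, and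
expand the product over the rows of \<open>x I - L\<close>. At each row either \<open>x\<close> is taken or a neighbour is
picked. The coefficient \<open>b\<^sub>\<lambda>\<^sub>,\<^sub>r\<close> thereby becomes a sum over all partial orientations \<open>f\<close>, which assign
to exactly \<open>r\<close> vertices one of their neighbours. The term of \<open>f\<close> is the sum of \<open>\<chi>\<^sub>\<lambda>(p)\<close> over all
permutations \<open>p\<close> that at each vertex stay or follow \<open>f\<close>, that is, over the products of subsets of
the directed cycles of \<open>f\<close>. In a bipartite graph such a permutation moves an even number of points,
and all signs cancel (\<open>imm_coeff_laplacian\<close>).

Each such term is a nonnegative integer. Characters take integer values, because the Specht module
has a basis in which the group acts by integer matrices (\<open>irr_char_Ints\<close>). The term of \<open>f\<close> is
\<open>\<chi>\<^sub>\<lambda>(a)\<close> for the product \<open>a\<close> of all \<open>1 + C\<close>, where \<open>C\<close> runs through the disjoint cycles of \<open>f\<close>. A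
permutation is conjugate to its inverse by a permutation that moves no further points, so that the
cycles can be reversed independently of each other without changing the character, and
\<open>\<chi>\<^sub>\<lambda>(a a\<^sup>*)\<close> is a positive multiple of \<open>\<chi>\<^sub>\<lambda>(a)\<close>. The former is nonnegative because the module is
unitary (\<open>irr_char_positive_definite\<close>, \<open>sum_cycle_choices_nonneg\<close>).

A shift with recipient \<open>u\<close> and donor \<open>w\<close> detaches from \<open>w\<close> the part of the graph that hangs there
and attaches it to \<open>u\<close>. There is an injection from the orientations of the shifted graph into those
of the original graph that preserves the number of oriented vertices and the cycle type. If \<open>u\<close> is
not oriented into the moved part, the same choices are made in the original graph. If it is, then
the orientation of the path is reversed, so that the choice of \<open>u\<close> is made by \<open>w\<close>. By the
hypotheses on the path, \<open>u\<close> and \<open>w\<close> are connected in no other way, which is why corresponding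
orientations have cycles of the same lengths (\<open>path_shift.sum_cycle_choices_pull_back\<close>). Since all
terms are nonnegative, the sum for the shifted graph is at most the sum for the original graph
(\<open>path_shift.sum_orientations_le\<close>).\<close>

section \<open>Subgroups of integer-valued functions\<close>

(* inv is to denote the inverse of a function, not the inverse in a monoid. *)
unbundle no m_inv_syntax

text \<open>A subgroup of \<open>\<int>\<^sup>P\<close> is free, and by echelon form it has a basis that is independent even over the
complex numbers: for a coordinate \<open>x\<close>, some \<open>v\<close> in the subgroup has a least nonzero value
\<open>\<bar>v x\<bar>\<close>, division with remainder reduces every other element to one that vanishes at \<open>x\<close>, and the
elements that vanish at \<open>x\<close> are handled by induction on \<open>P\<close>. This is how integrality of the
characters is obtained: an operator that preserves such a subgroup has an integer matrix in
this basis.\<close>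

lemma integer_valued_subgroup_basis:
  fixes L :: "('a \<Rightarrow> complex) set"
  assumes "finite P"
    and "\<And>v x. v \<in> L \<Longrightarrow> x \<notin> P \<Longrightarrow> v x = 0"
    and "\<And>v x. v \<in> L \<Longrightarrow> v x \<in> \<int>"
    and "0 \<in> L"
    and "\<And>v w. v \<in> L \<Longrightarrow> w \<in> L \<Longrightarrow> v - w \<in> L"
  shows "\<exists>B. finite B \<and> B \<subseteq> L \<and> fun_vs.independent B \<and>
           (\<forall>v\<in>L. \<exists>k. v = (\<Sum>b\<in>B. fscale (of_int (k b)) b))"
  using assms
proof (induction P arbitrary: L)
  case empty
  have "v = 0" if "v \<in> L" for v using empty.prems(1)[OF that] by (auto simp: fun_eq_iff)
  hence "v = (\<Sum>b\<in>{}. fscale (of_int 0) b)" if "v \<in> L" for v using that by simp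
  thus ?case using fun_vs.independent_empty by (intro exI[of _ "{}"] conjI ballI exI[of _ "\<lambda>_. 0"])
    (auto simp: zero_fun_def)
next
  case (insert x P)
  note int = insert.prems(2) and zero = insert.prems(3) and diff = insert.prems(4)
  define L' where "L' = {v \<in> L. v x = 0}"
  have "\<exists>B. finite B \<and> B \<subseteq> L' \<and> fun_vs.independent B \<and>
           (\<forall>v\<in>L'. \<exists>k. v = (\<Sum>b\<in>B. fscale (of_int (k b)) b))"
  proof (rule insert.IH)
    fix v y assume "v \<in> L'" "y \<notin> P"
    thus "v y = 0" using insert.prems(1)[of v y] by (cases "y = x") (auto simp: L'_def)
  qed (use int zero diff in \<open>auto simp: L'_def\<close>)
  then obtain B where B: "finite B" "B \<subseteq> L'" "fun_vs.independent B"
    "\<And>v. v \<in> L' \<Longrightarrow> \<exists>k. v = (\<Sum>b\<in>B. fscale (of_int (k b)) b)" by blast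
  show ?case
  proof (cases "L' = L")
    case True
    thus ?thesis using B by blast
  next
    case False
    define m where "m v = \<lfloor>Re (v x)\<rfloor>" for v :: "'a \<Rightarrow> complex"
    have m: "v x = of_int (m v)" if "v \<in> L" for v
      using int[OF that, of x] by (auto simp: m_def elim: Ints_cases)
    have "\<exists>v. v \<in> L \<and> m v \<noteq> 0" using False m by (auto simp: L'_def)
    then obtain v where v: "v \<in> L" "m v \<noteq> 0"
      and least: "\<And>w. w \<in> L \<and> m w \<noteq> 0 \<Longrightarrow> nat \<bar>m v\<bar> \<le> nat \<bar>m w\<bar>"
      using ex_has_least_nat[of "\<lambda>v. v \<in> L \<and> m v \<noteq> 0" _ "\<lambda>v. nat \<bar>m v\<bar>"] by blast
    have add: "a + b \<in> L" if "a \<in> L" "b \<in> L" for a b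
    proof -
      have "a - (0 - b) \<in> L" using diff that zero by blast
      thus ?thesis by simp
    qed
    have mult_nat: "fscale (of_nat j) a \<in> L" if "a \<in> L" for a j
    proof (induction j)
      case (Suc j)
      have "fscale (of_nat (Suc j)) a = fscale (of_nat j) a + a"
        by (auto simp: fscale_def fun_eq_iff algebra_simps)
      thus ?case using add[OF Suc that] by metis
    qed (use zero in \<open>simp add: fscale_def zero_fun_def\<close>)
    have mult: "fscale (of_int j) a \<in> L" if "a \<in> L" for a j
    proof (cases "j \<ge> 0")
      case True
      thus ?thesis using mult_nat[OF that, of "nat j"] by (simp add: of_nat_nat)
    next
      case False
      hence "fscale (of_int j) a = 0 - fscale (of_nat (nat (- j))) a"
        by (auto simp: fscale_def fun_eq_iff of_nat_nat)
      thus ?thesis using diff[OF zero mult_nat[OF that]] by metis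
    qed
    have red: "w - fscale (of_int (m w div m v)) v \<in> L'" if w: "w \<in> L" for w
    proof -
      let ?r = "w - fscale (of_int (m w div m v)) v"
      have rL: "?r \<in> L" using diff[OF w mult[OF v(1)]] .
      have "?r x = of_int (m w mod m v)"
        by (simp add: fscale_def m[OF w] m[OF v(1)] minus_div_mult_eq_mod[symmetric])
      hence mr: "m ?r = m w mod m v" by (simp add: m_def)
      have "\<bar>m w mod m v\<bar> < \<bar>m v\<bar>" using v(2) by (rule abs_mod_less)
      hence "m ?r = 0" using least[of ?r] rL v mr by force
      thus ?thesis using rL m[OF rL] by (simp add: L'_def)
    qed
    have "b x = 0" if "b \<in> fun_vs.span B" for b
      using that B(2) by (induction rule: fun_vs.span_induct_alt)
        (auto simp: fscale_def L'_def)
    hence vnot: "v \<notin> fun_vs.span B" using v m[OF v(1)] by (metis of_int_eq_0_iff)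
    hence vB: "v \<notin> B" using fun_vs.span_base by blast
    have "\<exists>k. w = (\<Sum>b\<in>insert v B. fscale (of_int (k b)) b)" if w: "w \<in> L" for w
    proof -
      obtain k where k: "w - fscale (of_int (m w div m v)) v = (\<Sum>b\<in>B. fscale (of_int (k b)) b)"
        using B(4)[OF red[OF w]] by blast
      let ?k = "k(v := m w div m v)"
      have "(\<Sum>b\<in>B. fscale (of_int (?k b)) b) = (\<Sum>b\<in>B. fscale (of_int (k b)) b)"
        using vB by (intro sum.cong) auto
      hence "w = (\<Sum>b\<in>insert v B. fscale (of_int (?k b)) b)"
        using k B(1) vB by (simp add: algebra_simps)
      thus ?thesis by blast
    qed
    moreover have "fun_vs.independent (insert v B)"
      using B(3) vnot by (rule fun_vs.independent_insertI[rotated])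
    moreover have "insert v B \<subseteq> L" using v B(2) by (auto simp: L'_def)
    ultimately show ?thesis using B(1) by (intro exI[of _ "insert v B"]) auto
  qed
qed

section \<open>Traces in orthogonal bases\<close>

definition inner_on :: "'a set \<Rightarrow> ('a \<Rightarrow> complex) \<Rightarrow> ('a \<Rightarrow> complex) \<Rightarrow> complex" where
  "inner_on P f g = (\<Sum>x\<in>P. f x * cnj (g x))"

lemma inner_on_simps:
  "inner_on P 0 g = 0"
  "inner_on P (f + f') g = inner_on P f g + inner_on P f' g"
  "inner_on P (f - f') g = inner_on P f g - inner_on P f' g"
  "inner_on P (fscale c f) g = c * inner_on P f g"
  "inner_on P f (fscale c g) = cnj c * inner_on P f g"
  by (simp_all add: inner_on_def fscale_def algebra_simps sum.distrib sum_subtractf sum_distrib_left)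

lemma sum_fun_apply: "(\<Sum>i\<in>I. f i) x = (\<Sum>i\<in>I. f i x :: 'b :: comm_monoid_add)"
  by (induction I rule: infinite_finite_induct) simp_all

lemma inner_on_sum_left: "inner_on P (\<Sum>i\<in>I. f i) g = (\<Sum>i\<in>I. inner_on P (f i) g)"
  unfolding inner_on_def sum_fun_apply sum_distrib_right by (rule sum.swap)

lemma cnj_inner_on: "cnj (inner_on P f g) = inner_on P g f"
  by (simp add: inner_on_def mult.commute)

lemma inner_on_sum_right: "inner_on P g (\<Sum>i\<in>I. f i) = (\<Sum>i\<in>I. inner_on P g (f i))"
  using inner_on_sum_left[of P f I g, THEN arg_cong[of _ _ cnj]]
  by (simp add: cnj_inner_on cnj_sum)

lemma inner_on_self_of_real: "inner_on P f f = of_real (\<Sum>x\<in>P. (cmod (f x))\<^sup>2)"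
  by (simp add: inner_on_def complex_norm_square[symmetric])

lemma inner_on_self_divide_nonneg: "inner_on P f f / inner_on P g g \<ge> 0"
  unfolding inner_on_self_of_real of_real_divide[symmetric]
  by (simp add: less_eq_complex_def sum_nonneg divide_nonneg_nonneg)

lemma inner_on_self_eq_0:
  assumes "finite P" "\<And>x. x \<notin> P \<Longrightarrow> f x = 0" "inner_on P f f = 0"
  shows "f = 0"
proof
  fix x
  have "(\<Sum>x\<in>P. (cmod (f x))\<^sup>2) = 0"
    using assms(3) unfolding inner_on_self_of_real by (simp only: of_real_eq_0_iff)
  hence "\<forall>x\<in>P. f x = 0" using assms(1) by (simp add: sum_nonneg_eq_0_iff)
  thus "f x = 0 x" using assms(2) by (cases "x \<in> P") auto
qed

definition orthogonal_on :: "'a set \<Rightarrow> ('a \<Rightarrow> complex) set \<Rightarrow> bool" where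
  "orthogonal_on P B \<longleftrightarrow>
     (\<forall>b\<in>B. inner_on P b b \<noteq> 0) \<and> (\<forall>b\<in>B. \<forall>c\<in>B. b \<noteq> c \<longrightarrow> inner_on P b c = 0)"

lemma span_supported:
  assumes "\<And>v. v \<in> S \<Longrightarrow> v x = 0" "f \<in> fun_vs.span S"
  shows "f x = 0"
  using assms(2) by (induction rule: fun_vs.span_induct_alt) (auto simp: fscale_def assms(1))

text \<open>The Gram--Schmidt process, without normalisation of the vectors.\<close>

lemma orthogonal_basis_exists:
  assumes "finite P" "finite S" "\<And>v x. v \<in> S \<Longrightarrow> x \<notin> P \<Longrightarrow> v x = 0"
  shows "\<exists>B. finite B \<and> orthogonal_on P B \<and> fun_vs.span B = fun_vs.span S"
  using assms(2,3)
proof (induction S)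
  case empty
  thus ?case by (intro exI[of _ "{}"]) (auto simp: orthogonal_on_def)
next
  case (insert v S)
  obtain B where B: "finite B" "orthogonal_on P B" "fun_vs.span B = fun_vs.span S"
    using insert.IH insert.prems by blast
  have span_eq: "fun_vs.span (insert v B) = fun_vs.span (insert v S)"
    by (simp add: fun_vs.span_insert B(3))
  define p where "p = (\<Sum>b\<in>B. fscale (inner_on P v b / inner_on P b b) b)"
  have p: "p \<in> fun_vs.span B"
    unfolding p_def by (intro fun_vs.span_sum fun_vs.span_scale fun_vs.span_base)
  have orth: "inner_on P (v - p) b = 0" if b: "b \<in> B" for b
  proof -
    have "inner_on P p b = (\<Sum>c\<in>B. inner_on P v c / inner_on P c c * inner_on P c b)"
      by (simp add: p_def inner_on_sum_left inner_on_simps)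
    also have "\<dots> = (\<Sum>c\<in>B. if c = b then inner_on P v b else 0)"
      using B(2) b by (intro sum.cong) (auto simp: orthogonal_on_def)
    also have "\<dots> = inner_on P v b" using b B(1) by simp
    finally show ?thesis by (simp add: inner_on_simps)
  qed
  have eq': "fun_vs.span (insert (v - p) B) = fun_vs.span (insert v B)"
  proof (rule fun_vs.span_eq[THEN iffD2], intro conjI subsetI)
    fix x assume "x \<in> insert (v - p) B"
    moreover have "p \<in> fun_vs.span (insert v B)"
      using p fun_vs.span_mono[of B "insert v B"] by blast
    ultimately show "x \<in> fun_vs.span (insert v B)"
      by (auto intro: fun_vs.span_diff fun_vs.span_base)
  next
    fix x assume x: "x \<in> insert v B"
    have "p \<in> fun_vs.span (insert (v - p) B)"
      using p fun_vs.span_mono[of B "insert (v - p) B"] by blast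
    hence "(v - p) + p \<in> fun_vs.span (insert (v - p) B)"
      by (intro fun_vs.span_add) (auto intro: fun_vs.span_base)
    thus "x \<in> fun_vs.span (insert (v - p) B)"
      using x by (auto intro: fun_vs.span_base)
  qed
  show ?case
  proof (cases "v - p = 0")
    case True
    hence "v \<in> fun_vs.span B" using p by simp
    hence "fun_vs.span (insert v B) = fun_vs.span B"
      by (rule fun_vs.span_redundant)
    thus ?thesis using B span_eq by auto
  next
    case False
    have "(v - p) x = 0" if "x \<notin> P" for x
    proof (rule span_supported[where f = "v - p" and S = "insert v S"])
      show "v - p \<in> fun_vs.span (insert v S)"
        using p span_eq eq' by (metis fun_vs.span_base insertI1)
    qed (use insert.prems that in auto)
    hence "inner_on P (v - p) (v - p) \<noteq> 0"
      using inner_on_self_eq_0[OF assms(1)] False by blast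
    moreover have "inner_on P b (v - p) = 0" if "b \<in> B" for b
      using orth[OF that] cnj_inner_on[of P "v - p" b] by simp
    ultimately have "orthogonal_on P (insert (v - p) B)"
      using B(2) orth by (auto simp: orthogonal_on_def)
    thus ?thesis using B(1) eq' span_eq by (intro exI[of _ "insert (v - p) B"]) auto
  qed
qed

lemma orthogonal_on_sum:
  assumes "finite B" "orthogonal_on P B" "b \<in> B"
  shows "inner_on P (\<Sum>c\<in>B. fscale (k c) c) b = k b * inner_on P b b"
proof -
  have "inner_on P (\<Sum>c\<in>B. fscale (k c) c) b = (\<Sum>c\<in>B. if c = b then k b * inner_on P b b else 0)"
    unfolding inner_on_sum_left inner_on_simps
    using assms(2,3) by (intro sum.cong) (auto simp: orthogonal_on_def)
  thus ?thesis using assms by simp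
qed

lemma orthogonal_on_independent:
  assumes "finite B" "orthogonal_on P B"
  shows "fun_vs.independent B"
proof (rule fun_vs.independent_if_scalars_zero[OF assms(1)])
  fix k b assume "(\<Sum>c\<in>B. fscale (k c) c) = 0" "b \<in> B"
  thus "k b = 0"
    using orthogonal_on_sum[OF assms, of b k] assms(2)
    by (auto simp: inner_on_simps orthogonal_on_def)
qed

text \<open>In an orthogonal basis the coordinates are inner products, so that unitarity of the group
action becomes usable for traces.\<close>

lemma trace_on_orthogonal:
  assumes "Vector_Spaces.linear fscale fscale T" "T ` W \<subseteq> W"
    and B: "finite B" "orthogonal_on P B" "fun_vs.span B = W"
  shows "trace_on W T = (\<Sum>b\<in>B. inner_on P (T b) b / inner_on P b b)"
proof -
  note ind = orthogonal_on_independent[OF B(1,2)]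
  have "trace_on W T = (\<Sum>b\<in>B. fun_vs.representation B (T b) b)"
    by (rule trace_on_eq) (use assms ind in auto)
  also have "\<dots> = (\<Sum>b\<in>B. inner_on P (T b) b / inner_on P b b)"
  proof (intro sum.cong refl)
    fix b assume b: "b \<in> B"
    have "T b \<in> fun_vs.span B" using b B(3) assms(2) fun_vs.span_base by blast
    hence "T b = (\<Sum>c\<in>B. fscale (fun_vs.representation B (T b) c) c)"
      using fun_vs.sum_representation_eq[OF ind _ B(1) order_refl] by simp
    hence "inner_on P (T b) b = fun_vs.representation B (T b) b * inner_on P b b"
      using orthogonal_on_sum[OF B(1,2) b] by metis
    thus "fun_vs.representation B (T b) b = inner_on P (T b) b / inner_on P b b"
      using B(2) b by (auto simp: orthogonal_on_def)
  qed
  finally show ?thesis .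
qed

section \<open>The character of a Specht module\<close>

lemma linear_left_mult: "Vector_Spaces.linear fscale fscale (left_mult g)"
  by unfold_locales (auto simp: left_mult_def fscale_def fun_eq_iff algebra_simps)

lemma left_mult_left_mult:
  assumes "bij g" "bij h"
  shows "left_mult g (left_mult h f) = left_mult (g \<circ> h) f"
  using assms by (simp add: left_mult_def o_inv_distrib comp_assoc)

lemma inner_on_left_mult:
  assumes "g permutes S"
  shows "inner_on {p. p permutes S} (left_mult g f) (left_mult g f') = inner_on {p. p permutes S} f f'"
proof -
  have "bij_betw (\<lambda>p. inv g \<circ> p) {p. p permutes S} {p. p permutes S}"
    using assms
    by (intro bij_betwI[of _ _ _ "\<lambda>p. g \<circ> p"])
      (auto simp: permutes_compose permutes_inv permutes_inv_o comp_assoc[symmetric])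
  thus ?thesis unfolding inner_on_def left_mult_def
    by (rule sum.reindex_bij_betw)
qed

context
  fixes lam :: "nat list"
begin

private abbreviation "n \<equiv> sum_list lam"
private abbreviation "Sym \<equiv> {p. p permutes {0..<n}}"
private abbreviation "W \<equiv> specht_module lam"

private lemma finite_Sym: "finite Sym"
  by (rule finite_permutations) simp

private lemma young_symmetrizer_Ints: "young_symmetrizer lam s \<in> \<int>"
  unfolding young_symmetrizer_def by (intro Ints_sum) auto

private lemma young_symmetrizer_supported:
  assumes "s \<notin> Sym"
  shows "young_symmetrizer lam s = 0"
  unfolding young_symmetrizer_def
  using assms by (intro sum.neutral ballI) (auto simp: row_group_def col_group_def permutes_compose)

private definition "gens = (\<lambda>g. left_mult g (young_symmetrizer lam)) ` Sym"

private lemma specht_eq: "W = fun_vs.span gens"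
  by (simp add: specht_module_def gens_def)

private lemma gens: "finite gens" "v \<in> gens \<Longrightarrow> v x \<in> \<int>" "v \<in> gens \<Longrightarrow> x \<notin> Sym \<Longrightarrow> v x = 0"
proof -
  show "finite gens" unfolding gens_def using finite_Sym by simp
  show "v x \<in> \<int>" if "v \<in> gens"
    using that young_symmetrizer_Ints by (auto simp: gens_def left_mult_def)
  show "v x = 0" if v: "v \<in> gens" and x: "x \<notin> Sym"
  proof -
    obtain g where g: "g permutes {0..<n}" "v = left_mult g (young_symmetrizer lam)"
      using v by (auto simp: gens_def)
    have "inv g \<circ> x \<notin> Sym"
    proof
      assume "inv g \<circ> x \<in> Sym"
      hence "g \<circ> (inv g \<circ> x) permutes {0..<n}" using g(1) permutes_compose by blast
      thus False using x g(1) by (simp add: comp_assoc[symmetric] permutes_inv_o)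
    qed
    thus ?thesis using young_symmetrizer_supported g(2) by (simp add: left_mult_def)
  qed
qed

private lemma specht_supported: "v \<in> W \<Longrightarrow> x \<notin> Sym \<Longrightarrow> v x = 0"
  unfolding specht_eq using span_supported[of gens x v] gens(3) by blast

private lemma left_mult_specht:
  assumes g: "g permutes {0..<n}" and v: "v \<in> W"
  shows "left_mult g v \<in> W"
proof -
  interpret T: Vector_Spaces.linear fscale fscale "left_mult g" by (rule linear_left_mult)
  have "left_mult g x \<in> gens" if x: "x \<in> gens" for x
  proof -
    obtain h where h: "h permutes {0..<n}" "x = left_mult h (young_symmetrizer lam)"
      using x by (auto simp: gens_def)
    hence "left_mult g x = left_mult (g \<circ> h) (young_symmetrizer lam)"
      using g by (simp add: left_mult_left_mult permutes_bij)
    thus ?thesis using permutes_compose[OF h(1) g] by (auto simp: gens_def)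
  qed
  hence "left_mult g ` fun_vs.span gens \<subseteq> fun_vs.span gens"
    unfolding T.span_image[symmetric] by (intro fun_vs.span_mono) auto
  thus ?thesis using v unfolding specht_eq by blast
qed

private lemma left_mult_image: "g permutes {0..<n} \<Longrightarrow> left_mult g ` W \<subseteq> W"
  using left_mult_specht by auto

text \<open>The elements of the Specht module with integer values form a subgroup that is stable under the
group and contains the generators, because the Young symmetrizer has integer values.\<close>

lemma irr_char_Ints:
  assumes g: "g permutes {0..<n}"
  shows "irr_char lam g \<in> \<int>"
proof -
  define L where "L = {v \<in> W. \<forall>x. v x \<in> \<int>}"
  have sub: "fun_vs.subspace W" unfolding specht_eq by (rule fun_vs.subspace_span)
  have "0 \<in> L" using fun_vs.subspace_0[OF sub] by (auto simp: L_def)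
  moreover have "v - w \<in> L" if "v \<in> L" "w \<in> L" for v w
    using that fun_vs.subspace_diff[OF sub] by (auto simp: L_def)
  ultimately have "\<exists>B. finite B \<and> B \<subseteq> L \<and> fun_vs.independent B \<and>
           (\<forall>v\<in>L. \<exists>k. v = (\<Sum>b\<in>B. fscale (of_int (k b)) b))"
    by (intro integer_valued_subgroup_basis[OF finite_Sym])
      (use specht_supported in \<open>auto simp: L_def\<close>)
  then obtain B where B: "finite B" "B \<subseteq> L" "fun_vs.independent B"
    "\<And>v. v \<in> L \<Longrightarrow> \<exists>k. v = (\<Sum>b\<in>B. fscale (of_int (k b)) b)" by blast
  have span: "fun_vs.span B = W"
  proof
    have "B \<subseteq> W" using B(2) by (auto simp: L_def)
    thus "fun_vs.span B \<subseteq> W" using fun_vs.span_minimal sub by blast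
    have "gens \<subseteq> L" using fun_vs.span_base gens(2) unfolding L_def specht_eq by blast
    moreover have "v \<in> fun_vs.span B" if v: "v \<in> L" for v
    proof -
      obtain k where k: "v = (\<Sum>b\<in>B. fscale (of_int (k b)) b)" using B(4)[OF v] by blast
      show ?thesis unfolding k by (intro fun_vs.span_sum fun_vs.span_scale fun_vs.span_base)
    qed
    ultimately have "gens \<subseteq> fun_vs.span B" by blast
    thus "W \<subseteq> fun_vs.span B" unfolding specht_eq
      using fun_vs.span_minimal fun_vs.subspace_span by blast
  qed
  have "irr_char lam g = (\<Sum>b\<in>B. fun_vs.representation B (left_mult g b) b)"
    unfolding irr_char_def
    by (rule trace_on_eq[OF linear_left_mult left_mult_image[OF g] B(1,3) span])
  moreover have "fun_vs.representation B (left_mult g b) b \<in> \<int>" if b: "b \<in> B" for b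
  proof -
    have "left_mult g b \<in> L"
      using b B(2) left_mult_specht[OF g] by (auto simp: L_def left_mult_def)
    then obtain k where k: "left_mult g b = (\<Sum>b\<in>B. fscale (of_int (k b)) b)"
      using B(4) by blast
    have "fun_vs.representation B (\<Sum>c\<in>B. fscale (of_int (k c)) c) b =
        (\<Sum>c\<in>B. of_int (k c) * fun_vs.representation B c b)"
      by (subst fun_vs.representation_sum[OF B(3)])
        (auto simp: fun_vs.representation_scale[OF B(3)] fun_vs.span_base fun_vs.span_scale)
    also have "\<dots> = (\<Sum>c\<in>B. if c = b then of_int (k b) else 0)"
      by (intro sum.cong) (auto simp: fun_vs.representation_basis[OF B(3)])
    also have "\<dots> = of_int (k b)" using B(1) b by simp
    finally show ?thesis using k by simp
  qed
  ultimately show ?thesis by auto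
qed

private lemma orthogonal_basis:
  obtains B where "finite B" "orthogonal_on Sym B" "fun_vs.span B = W"
proof -
  have "\<exists>B. finite B \<and> orthogonal_on Sym B \<and> fun_vs.span B = fun_vs.span gens"
    using orthogonal_basis_exists[OF finite_Sym gens(1)] gens(3) by blast
  thus ?thesis using that by (auto simp: specht_eq)
qed

private lemma irr_char_orthogonal:
  assumes "g permutes {0..<n}" "finite B" "orthogonal_on Sym B" "fun_vs.span B = W"
  shows "irr_char lam g = (\<Sum>b\<in>B. inner_on Sym (left_mult g b) b / inner_on Sym b b)"
  unfolding irr_char_def
  by (rule trace_on_orthogonal[OF linear_left_mult left_mult_image[OF assms(1)] assms(2-4)])

text \<open>Left multiplication by \<open>t\<close> is unitary, so it takes an orthogonal basis of the module to another
one; computing the trace of \<open>t \<circ> g \<circ> inv t\<close> in the new basis gives the trace of \<open>g\<close> in the old.\<close>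

lemma irr_char_conjugate:
  assumes g: "g permutes {0..<n}" and t: "t permutes {0..<n}"
  shows "irr_char lam (t \<circ> g \<circ> inv t) = irr_char lam g"
proof -
  obtain B where B: "finite B" "orthogonal_on Sym B" "fun_vs.span B = W"
    by (rule orthogonal_basis)
  interpret T: Vector_Spaces.linear fscale fscale "left_mult t" by (rule linear_left_mult)
  have t': "inv t permutes {0..<n}" using t by (rule permutes_inv)
  have left_inv: "left_mult (inv t) (left_mult t v) = v" for v
    using t t' by (simp add: left_mult_left_mult permutes_bij permutes_inv_o)
      (simp add: left_mult_def)
  have right_inv: "left_mult t (left_mult (inv t) v) = v" for v
    using t t' by (simp add: left_mult_left_mult permutes_bij permutes_inv_o)
      (simp add: left_mult_def)
  have inj: "inj_on (left_mult t) B" by (rule inj_on_inverseI) (rule left_inv)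
  have "left_mult t ` W = W"
  proof
    show "W \<subseteq> left_mult t ` W"
    proof
      fix v assume "v \<in> W"
      thus "v \<in> left_mult t ` W"
        using left_mult_specht[OF t'] right_inv[of v] by (intro image_eqI[of _ _ "left_mult (inv t) v"]) auto
    qed
  qed (rule left_mult_image[OF t])
  hence span: "fun_vs.span (left_mult t ` B) = W" by (simp add: T.span_image B(3))
  have orth: "orthogonal_on Sym (left_mult t ` B)"
    using B(2) by (auto simp: orthogonal_on_def inner_on_left_mult[OF t])
  have conj: "t \<circ> g \<circ> inv t permutes {0..<n}"
    using g t t' by (intro permutes_compose)
  have "left_mult (t \<circ> g \<circ> inv t) (left_mult t b) = left_mult t (left_mult g b)" for b
  proof -
    have "left_mult (t \<circ> g \<circ> inv t) (left_mult t b) = left_mult (t \<circ> g \<circ> (inv t \<circ> t)) b"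
      using conj t by (simp add: left_mult_left_mult permutes_bij comp_assoc)
    thus ?thesis using g t by (simp add: left_mult_left_mult permutes_bij permutes_inv_o)
  qed
  hence "irr_char lam (t \<circ> g \<circ> inv t) =
      (\<Sum>b\<in>B. inner_on Sym (left_mult t (left_mult g b)) (left_mult t b) /
            inner_on Sym (left_mult t b) (left_mult t b))"
    using irr_char_orthogonal[OF conj finite_imageI[OF B(1)] orth span]
    by (simp add: sum.reindex[OF inj])
  thus ?thesis using irr_char_orthogonal[OF g B] by (simp add: inner_on_left_mult[OF t])
qed

text \<open>For an orthogonal basis \<open>B\<close> of the module the double sum equals
\<open>\<Sum>b\<in>B. \<parallel>\<Sum>g\<in>H. g\<inverse> b\<parallel>\<^sup>2 / \<parallel>b\<parallel>\<^sup>2\<close>, since the group acts by unitary operators.\<close>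

lemma irr_char_positive_definite:
  assumes "finite H" "H \<subseteq> {p. p permutes {0..<n}}"
  shows "(\<Sum>g\<in>H. \<Sum>h\<in>H. irr_char lam (g \<circ> inv h)) \<ge> 0"
proof -
  obtain B where B: "finite B" "orthogonal_on Sym B" "fun_vs.span B = W"
    by (rule orthogonal_basis)
  define w where "w b = (\<Sum>g\<in>H. left_mult (inv g) b)" for b
  have move: "inner_on Sym (left_mult (g \<circ> inv h) b) b =
      inner_on Sym (left_mult (inv h) b) (left_mult (inv g) b)" if "g \<in> H" "h \<in> H" for g h b
  proof -
    have gh: "g permutes {0..<n}" "h permutes {0..<n}" using that assms by auto
    have "left_mult (inv g) (left_mult (g \<circ> inv h) b) = left_mult (inv g \<circ> (g \<circ> inv h)) b"
      using gh by (intro left_mult_left_mult permutes_bij[of _ "{0..<n}"] permutes_inv permutes_compose)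
    also have "inv g \<circ> (g \<circ> inv h) = inv h"
      using gh by (simp add: comp_assoc[symmetric] permutes_inv_o)
    finally show ?thesis
      using inner_on_left_mult[OF permutes_inv[OF gh(1)], of "left_mult (g \<circ> inv h) b" b] by metis
  qed
  define F where "F g h b = inner_on Sym (left_mult (inv h) b) (left_mult (inv g) b) / inner_on Sym b b"
    for g h b
  have "irr_char lam (g \<circ> inv h) = (\<Sum>b\<in>B. F g h b)" if "g \<in> H" "h \<in> H" for g h
  proof -
    have "g \<circ> inv h permutes {0..<n}"
      using that assms(2) by (intro permutes_compose permutes_inv) auto
    thus ?thesis
      using irr_char_orthogonal[OF _ B, of "g \<circ> inv h"] move[OF that] by (simp add: F_def)
  qed
  hence "(\<Sum>g\<in>H. \<Sum>h\<in>H. irr_char lam (g \<circ> inv h)) = (\<Sum>g\<in>H. \<Sum>h\<in>H. \<Sum>b\<in>B. F g h b)"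
    by (intro sum.cong refl) blast
  also have "\<dots> = (\<Sum>g\<in>H. \<Sum>b\<in>B. \<Sum>h\<in>H. F g h b)"
    by (rule sum.cong[OF refl sum.swap])
  also have "\<dots> = (\<Sum>b\<in>B. \<Sum>g\<in>H. \<Sum>h\<in>H. F g h b)"
    by (rule sum.swap)
  also have "\<dots> = (\<Sum>b\<in>B. inner_on Sym (w b) (w b) / inner_on Sym b b)"
    by (simp add: w_def F_def inner_on_sum_left inner_on_sum_right sum_divide_distrib)
  also have "\<dots> \<ge> 0"
    by (intro sum_nonneg inner_on_self_divide_nonneg)
  finally show ?thesis .
qed

end

section \<open>Conjugacy of a permutation and its inverse\<close>

text \<open>In a dihedral picture, \<open>t\<close> reflects every cycle of \<open>b\<close>: with a base point \<open>r\<close> chosen on each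
cycle, it takes \<open>b\<^sup>k r\<close> to \<open>(inv b)\<^sup>k r\<close>. It matters below that \<open>t\<close> moves no point outside \<open>S\<close>: the
cycles in \<open>S\<close> are reversed while all other cycles of a larger permutation stay as they are.\<close>

lemma permutation_conjugate_inverse:
  fixes b :: "'a \<Rightarrow> 'a"
  assumes "finite S" "b permutes S"
  obtains t where "t permutes S" "t \<circ> b = inv b \<circ> t"
proof -
  have pb: "permutation b" using assms by (auto simp: permutation_permutes)
  have inv_b: "inv b (b x) = x" "b (inv b x) = x" for x
    using permutes_inverses[OF assms(2)] by auto
  have pow1: "(inv b ^^ m) ((b ^^ m) x) = x" for m x
    by (induction m arbitrary: x) (simp_all add: funpow_swap1 inv_b)
  have pow2: "(b ^^ m) ((inv b ^^ m) x) = x" for m x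
    by (induction m arbitrary: x) (simp_all add: funpow_swap1 inv_b)
  have comm: "(g ^^ m) ((g ^^ k) x) = (g ^^ k) ((g ^^ m) x)" for g :: "'a \<Rightarrow> 'a" and m k x
    by (metis add.commute comp_apply funpow_add)
  have flip: "(inv b ^^ m) y = (inv b ^^ k) y" if "(b ^^ m) y = (b ^^ k) y" for m k y
  proof -
    have "(inv b ^^ m) y = (inv b ^^ m) ((inv b ^^ k) ((b ^^ k) y))" by (simp only: pow1)
    also have "\<dots> = (inv b ^^ k) ((inv b ^^ m) ((b ^^ m) y))" by (simp only: comm that)
    finally show ?thesis by (simp only: pow1)
  qed
  have flip': "(inv b ^^ m) y = (b ^^ k) y" if "(b ^^ m) y = (inv b ^^ k) y" for m k y
  proof -
    have "(inv b ^^ m) y = (inv b ^^ m) ((b ^^ k) ((inv b ^^ k) y))" by (simp only: pow2)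
    also have "\<dots> = (inv b ^^ m) ((b ^^ m) ((b ^^ k) y))" by (simp only: that[symmetric] comm)
    finally show ?thesis by (simp only: pow1)
  qed
  define r where "r x = (SOME y. y \<in> orbit b x)" for x
  define k where "k x = (SOME m. (b ^^ m) (r x) = x)" for x
  define t where "t x = (inv b ^^ k x) (r x)" for x
  have r_in: "r x \<in> orbit b x" for x
    unfolding r_def using permutation_self_in_orbit[OF pb] by (rule someI)
  have r_orbit: "x \<in> orbit b (r x)" for x
    using orbit_swap[OF permutation_self_in_orbit[OF pb] r_in] .
  have "\<exists>m. (b ^^ m) (r x) = x" for x
    using r_orbit[of x] by (auto simp: orbit_altdef_permutation[OF pb]) metis
  hence k: "(b ^^ k x) (r x) = x" for x unfolding k_def by (rule someI_ex)
  have r_step: "r (b x) = r x" for x by (simp add: r_def permutation_orbit_step[OF pb])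
  have "r ((b ^^ m) x) = r x" for m x by (induction m) (simp_all add: r_step)
  hence r_inv: "r ((inv b ^^ m) x) = r x" for m x by (metis pow2)
  have r_r: "r (r x) = r x" for x using k r_step \<open>\<And>m x. r ((b ^^ m) x) = r x\<close> by metis
  have "t (t x) = x" for x
  proof -
    have rt: "r (t x) = r x" by (simp add: t_def r_inv r_r)
    have "(b ^^ k (t x)) (r x) = (inv b ^^ k x) (r x)" using k[of "t x"] rt by (simp add: t_def)
    hence "(inv b ^^ k (t x)) (r x) = (b ^^ k x) (r x)" by (rule flip')
    thus ?thesis using k[of x] by (simp add: t_def[of "t x"] rt)
  qed
  hence "bij t" by (intro o_bij[of t]) (auto simp: fun_eq_iff)
  moreover have "t x = x" if "x \<notin> S" for x
  proof -
    have bx: "b x = x" using assms(2) that by (simp add: permutes_not_in)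
    hence "inv b x = x" using inv_b by metis
    hence "(inv b ^^ m) x = x" for m by (induction m) auto
    moreover have "r x = x" using r_in[of x] bx orbit_eq_singleton_iff[of b x] by auto
    ultimately show ?thesis by (simp add: t_def)
  qed
  ultimately have "t permutes S" by (auto simp: permutes_def bij_iff)
  moreover have "t (b x) = inv b (t x)" for x
  proof -
    have "(b ^^ k (b x)) (r x) = (b ^^ Suc (k x)) (r x)" using k[of "b x"] k[of x] r_step by simp
    hence "(inv b ^^ k (b x)) (r x) = (inv b ^^ Suc (k x)) (r x)" by (rule flip)
    thus ?thesis by (simp add: t_def r_step)
  qed
  ultimately show ?thesis using that by (auto simp: fun_eq_iff)
qed

section \<open>Choosing cycles of a functional digraph\<close>

text \<open>The map \<open>f\<close> is a functional digraph on \<open>V\<close>, where \<open>f i = i\<close> encodes that no arc leaves \<open>i\<close>. A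
permutation that at every vertex stays or follows the arc is a product of some of the directed
cycles of \<open>f\<close> in \<open>V\<close> of length at least two, and every set of cycles occurs exactly once.\<close>

definition cycle_choices :: "'a set \<Rightarrow> ('a \<Rightarrow> 'a) \<Rightarrow> ('a \<Rightarrow> 'a) set" where
  "cycle_choices V f = {p. p permutes V \<and> (\<forall>i. p i = i \<or> p i = f i)}"

lemma finite_cycle_choices: "finite V \<Longrightarrow> finite (cycle_choices V f)"
  by (rule finite_subset[OF _ finite_permutations]) (auto simp: cycle_choices_def)

lemma id_cycle_choices: "id \<in> cycle_choices V f"
  by (simp add: cycle_choices_def permutes_id)

lemma permutes_invariant_complement:
  assumes "p permutes V" "finite V" "D \<subseteq> V" "p ` D \<subseteq> D" "i \<notin> D"
  shows "p i \<notin> D"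
proof
  assume "p i \<in> D"
  have "inj p" using assms(1) by (rule permutes_inj)
  hence "p ` D = D" using assms finite_subset[OF assms(3,2)]
    by (intro endo_inj_surj) (auto intro: inj_on_subset)
  hence "\<exists>j\<in>D. p j = p i" using \<open>p i \<in> D\<close> by (metis imageE)
  thus False using \<open>inj p\<close> assms(5) by (auto dest: injD)
qed

lemma permutes_restrict_invariant:
  assumes "p permutes V" "finite X" "p ` X \<subseteq> X"
  shows "(\<lambda>i. if i \<in> X then p i else i) permutes X"
proof (rule bij_imp_permutes)
  have "inj_on p X" using permutes_inj[OF assms(1)] by (rule inj_on_subset) simp
  hence "bij_betw p X X" using assms(2,3) by (simp add: bij_betw_def endo_inj_surj)
  thus "bij_betw (\<lambda>i. if i \<in> X then p i else i) X X" by (simp cong: bij_betw_cong)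
qed auto

text \<open>For products \<open>p\<close> and \<open>q\<close> of cycles of \<open>f\<close>, this is the product over the symmetric difference of
the two sets of cycles.\<close>

definition choice_diff :: "('a \<Rightarrow> 'a) \<Rightarrow> ('a \<Rightarrow> 'a) \<Rightarrow> ('a \<Rightarrow> 'a) \<Rightarrow> 'a \<Rightarrow> 'a" where
  "choice_diff f q p = (\<lambda>i. if p i = q i then i else f i)"

text \<open>Cycles common to \<open>p\<close> and \<open>q\<close> cancel in \<open>p \<circ> inv q\<close>, the other cycles of \<open>p\<close> appear as they are
and those of \<open>q\<close> appear reversed. Reversing the latter again is a conjugation that leaves the
former alone.\<close>

lemma choice_diff_conjugate:
  assumes V: "finite V" and p: "p \<in> cycle_choices V f" and q: "q \<in> cycle_choices V f"
  shows "choice_diff f q p \<in> cycle_choices V f"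
    and "\<exists>t. t permutes V \<and> choice_diff f q p = t \<circ> (p \<circ> inv q) \<circ> inv t"
proof -
  have pV: "p permutes V" and qV: "q permutes V" using p q by (auto simp: cycle_choices_def)
  have p_cases: "p i = i \<or> p i = f i" and q_cases: "q i = i \<or> q i = f i" for i
    using p q by (auto simp: cycle_choices_def)
  have inj: "p i = p j \<longleftrightarrow> i = j" "q i = q j \<longleftrightarrow> i = j" for i j
    using permutes_inj[OF pV] permutes_inj[OF qV] by (auto dest: injD)
  \<comment> \<open>\<open>D\<close> carries the common cycles, \<open>A\<close> the other cycles of \<open>p\<close>, \<open>C\<close> those of \<open>q\<close>.\<close>
  define D where "D = {i. p i \<noteq> i \<and> q i \<noteq> i}"
  define A where "A = {i. p i \<noteq> i \<and> q i = i}"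
  define C where "C = {i. p i = i \<and> q i \<noteq> i}"
  have sub: "D \<subseteq> V" "A \<subseteq> V" "C \<subseteq> V"
    using permutes_not_in[OF pV] permutes_not_in[OF qV] by (auto simp: D_def A_def C_def)
  have fin: "finite A" "finite C" using finite_subset[OF _ V] sub by blast+
  have "p i = q i" if "i \<in> D" for i
    using that p_cases[of i] q_cases[of i] by (auto simp: D_def)
  hence D_img: "p ` D \<subseteq> D" "q ` D \<subseteq> D"
    using inj by (fastforce simp: D_def)+
  have A_inv: "p ` A \<subseteq> A"
    using permutes_invariant_complement[OF pV V sub(1) D_img(1)] inj
    by (auto simp: A_def D_def)
  have C_inv: "q ` C \<subseteq> C"
    using permutes_invariant_complement[OF qV V sub(1) D_img(2)] inj
    by (auto simp: C_def D_def)
  define a where "a = (\<lambda>i. if i \<in> A then p i else i)"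
  define b where "b = (\<lambda>i. if i \<in> C then q i else i)"
  have a: "a permutes A" unfolding a_def using pV fin(1) A_inv by (rule permutes_restrict_invariant)
  have b: "b permutes C" unfolding b_def using qV fin(2) C_inv by (rule permutes_restrict_invariant)
  have AC: "A \<inter> C = {}" by (auto simp: A_def C_def)
  have diff: "choice_diff f q p = a \<circ> b"
  proof
    fix i
    consider "i \<in> A" | "i \<in> C" | "i \<in> D" | "p i = i" "q i = i"
      by (auto simp: A_def C_def D_def)
    thus "choice_diff f q p i = (a \<circ> b) i"
    proof cases
      case 2
      hence "q i \<in> C" using C_inv by blast
      thus ?thesis using 2 AC q_cases[of i] by (auto simp: a_def b_def C_def choice_diff_def)
    qed (use AC p_cases[of i] q_cases[of i] in \<open>auto simp: a_def b_def A_def C_def D_def choice_diff_def\<close>)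
  qed
  have "a permutes V" "b permutes V" using a b sub by (auto intro: permutes_subset)
  hence "choice_diff f q p permutes V" unfolding diff by (intro permutes_compose)
  thus "choice_diff f q p \<in> cycle_choices V f" by (auto simp: cycle_choices_def choice_diff_def)
  have "(a \<circ> inv b) (q i) = p i" for i
  proof -
    have inv_b: "inv b j = j" if "j \<notin> C" for j
      using permutes_inv[OF b] that by (rule permutes_not_in)
    consider "i \<in> A" | "i \<in> C" | "i \<in> D" | "p i = i" "q i = i"
      by (auto simp: A_def C_def D_def)
    thus ?thesis
    proof cases
      case 2
      hence "inv b (q i) = i" using permutes_inverses(2)[OF b, of i] by (simp add: b_def)
      thus ?thesis using 2 by (auto simp: a_def A_def C_def)
    next
      case 3
      hence "q i \<in> D" using D_img by blast
      thus ?thesis using 3 inv_b[of "q i"] p_cases[of i] q_cases[of i]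
        by (auto simp: a_def A_def C_def D_def)
    qed (use inv_b[of i] in \<open>auto simp: a_def A_def C_def\<close>)
  qed
  hence "(a \<circ> inv b) \<circ> q = p" by auto
  hence pq: "p \<circ> inv q = a \<circ> inv b"
    by (metis comp_assoc comp_id permutes_inv_o(1)[OF qV])
  obtain t where t: "t permutes C" "t \<circ> b = inv b \<circ> t"
    using permutation_conjugate_inverse[OF fin(2) b] .
  have tV: "t permutes V" using t(1) sub(3) by (rule permutes_subset)
  have tb: "t \<circ> inv b = b \<circ> t"
  proof -
    have "t \<circ> inv b = b \<circ> (inv b \<circ> t) \<circ> inv b"
      by (simp add: comp_assoc[symmetric] permutes_inv_o[OF b])
    also have "\<dots> = b \<circ> t \<circ> (b \<circ> inv b)" by (simp add: t(2)[symmetric] comp_assoc)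
    finally show ?thesis by (simp add: permutes_inv_o[OF b])
  qed
  have "(t \<circ> a) i = (a \<circ> t) i" for i
  proof -
    consider "i \<in> A" | "i \<in> C" | "i \<notin> A" "i \<notin> C" by blast
    thus ?thesis
    proof cases
      case 1
      hence "a i \<in> A" using a by (simp add: permutes_in_image)
      thus ?thesis using 1 AC t(1) by (metis comp_apply disjoint_iff permutes_not_in)
    next
      case 2
      hence "t i \<in> C" using t(1) by (simp add: permutes_in_image)
      thus ?thesis using 2 AC a by (metis comp_apply disjoint_iff permutes_not_in)
    next
      case 3
      thus ?thesis using a t(1) by (simp add: permutes_not_in)
    qed
  qed
  hence ta: "t \<circ> a = a \<circ> t" by auto
  have "t \<circ> (p \<circ> inv q) \<circ> inv t = (t \<circ> a) \<circ> inv b \<circ> inv t" by (simp add: pq comp_assoc)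
  also have "\<dots> = a \<circ> (t \<circ> inv b) \<circ> inv t" by (simp add: ta comp_assoc)
  also have "\<dots> = a \<circ> b \<circ> (t \<circ> inv t)" by (simp add: tb comp_assoc)
  finally have "choice_diff f q p = t \<circ> (p \<circ> inv q) \<circ> inv t"
    by (simp add: diff permutes_inv_o[OF t(1)])
  thus "\<exists>t. t permutes V \<and> choice_diff f q p = t \<circ> (p \<circ> inv q) \<circ> inv t" using tV by blast
qed

lemma choice_diff_bij:
  assumes V: "finite V" and q: "q \<in> cycle_choices V f"
  shows "bij_betw (choice_diff f q) (cycle_choices V f) (cycle_choices V f)"
proof -
  have "inj_on (choice_diff f q) (cycle_choices V f)"
  proof (rule inj_onI)
    fix p p' assume p: "p \<in> cycle_choices V f" "p' \<in> cycle_choices V f"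
      and eq: "choice_diff f q p = choice_diff f q p'"
    have "g i = (if f i = i then i else if choice_diff f q g i = i then q i else if q i = i then f i else i)"
      if "g \<in> cycle_choices V f" for g i
    proof -
      have "g i = i \<or> g i = f i" "q i = i \<or> q i = f i" using that q by (auto simp: cycle_choices_def)
      thus ?thesis by (auto simp: choice_diff_def)
    qed
    hence "p i = p' i" for i using p eq by metis
    thus "p = p'" by auto
  qed
  moreover have "choice_diff f q ` cycle_choices V f \<subseteq> cycle_choices V f"
    using choice_diff_conjugate(1)[OF V _ q] by auto
  ultimately show ?thesis
    using finite_cycle_choices[OF V] by (simp add: bij_betw_def endo_inj_surj)
qed

text \<open>Let \<open>a\<close> be the sum of all elements of \<open>cycle_choices V f\<close> in the group algebra. By positive
definiteness \<open>chi (a a\<^sup>*) \<ge> 0\<close>. For each fixed \<open>q\<close> the elements \<open>p \<circ> inv q\<close> are, up to conjugation,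
the elements of \<open>cycle_choices V f\<close> once more, because taking the symmetric difference with a
fixed set of cycles is a bijection. Hence \<open>chi (a a\<^sup>*)\<close> is a positive multiple of \<open>chi a\<close>. Some
such argument is needed, as \<open>1 + C\<close> is no multiple of a projection if the cycle \<open>C\<close> has order
above two.\<close>

lemma sum_cycle_choices_nonneg:
  fixes chi :: "('a \<Rightarrow> 'a) \<Rightarrow> complex"
  assumes V: "finite V"
    and conj: "\<And>g t. g permutes V \<Longrightarrow> t permutes V \<Longrightarrow> chi (t \<circ> g \<circ> inv t) = chi g"
    and pos: "\<And>H. finite H \<Longrightarrow> H \<subseteq> {p. p permutes V} \<Longrightarrow> (\<Sum>g\<in>H. \<Sum>h\<in>H. chi (g \<circ> inv h)) \<ge> 0"
  shows "(\<Sum>p\<in>cycle_choices V f. chi p) \<ge> 0"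
proof -
  let ?H = "cycle_choices V f" and ?s = "\<Sum>p\<in>cycle_choices V f. chi p"
  have "(\<Sum>p\<in>?H. chi (p \<circ> inv q)) = ?s" if q: "q \<in> ?H" for q
  proof -
    have "chi (p \<circ> inv q) = chi (choice_diff f q p)" if p: "p \<in> ?H" for p
    proof -
      obtain t where t: "t permutes V" "choice_diff f q p = t \<circ> (p \<circ> inv q) \<circ> inv t"
        using choice_diff_conjugate(2)[OF V p q] by blast
      have "p \<circ> inv q permutes V" using p q by (auto simp: cycle_choices_def permutes_compose permutes_inv)
      thus ?thesis using conj[OF _ t(1)] t(2) by simp
    qed
    hence "(\<Sum>p\<in>?H. chi (p \<circ> inv q)) = (\<Sum>p\<in>?H. chi (choice_diff f q p))" by simp
    also have "\<dots> = ?s" by (rule sum.reindex_bij_betw[OF choice_diff_bij[OF V q]])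
    finally show ?thesis .
  qed
  hence "(\<Sum>q\<in>?H. \<Sum>p\<in>?H. chi (p \<circ> inv q)) = of_nat (card ?H) * ?s" by simp
  moreover have "(\<Sum>q\<in>?H. \<Sum>p\<in>?H. chi (p \<circ> inv q)) \<ge> 0"
    by (subst sum.swap, rule pos[OF finite_cycle_choices[OF V]]) (auto simp: cycle_choices_def)
  ultimately have "of_nat (card ?H) * ?s \<ge> 0" by simp
  moreover have "card ?H > 0"
    using finite_cycle_choices[OF V, of f] id_cycle_choices[of V f] card_gt_0_iff by blast
  ultimately show ?thesis by (simp add: less_eq_complex_def zero_le_mult_iff)
qed

section \<open>The coefficients as sums over orientations\<close>

text \<open>A vertex picks one of its neighbours, or stays unoriented, which \<open>f i = i\<close> encodes; for this the
relation has to be free of loops.\<close>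

definition orientations :: "('a \<Rightarrow> 'a \<Rightarrow> bool) \<Rightarrow> ('a \<Rightarrow> 'a) set" where
  "orientations E = {f. \<forall>i. f i = i \<or> E i (f i)}"

definition moved :: "('a \<Rightarrow> 'a) \<Rightarrow> 'a set" where
  "moved f = {i. f i \<noteq> i}"

lemma orientations_PiE_bij:
  assumes E: "\<And>i j. E i j \<Longrightarrow> i \<in> V"
  shows "bij_betw (\<lambda>f. restrict f V) (orientations E) (PiE V (\<lambda>i. insert i {j. E i j}))"
proof (rule bij_betw_byWitness[where f' = "\<lambda>g i. if i \<in> V then g i else i"])
  show "\<forall>f\<in>orientations E. (\<lambda>i. if i \<in> V then restrict f V i else i) = f"
    using E unfolding orientations_def fun_eq_iff by (auto simp: restrict_def) metis
  show "(\<lambda>f. restrict f V) ` orientations E \<subseteq> (\<Pi>\<^sub>E i\<in>V. insert i {j. E i j})"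
    by (auto simp: orientations_def)
  show "(\<lambda>g i. if i \<in> V then g i else i) ` (\<Pi>\<^sub>E i\<in>V. insert i {j. E i j}) \<subseteq> orientations E"
    by (fastforce simp: orientations_def PiE_iff)
qed (auto simp: fun_eq_iff PiE_def extensional_def)

lemma finite_orientations:
  assumes "finite V" and E: "\<And>i j. E i j \<Longrightarrow> i \<in> V \<and> j \<in> V"
  shows "finite (orientations E)"
proof -
  have "finite {j. E i j}" for i by (rule finite_subset[OF _ assms(1)]) (auto dest: E)
  hence "finite (PiE V (\<lambda>i. insert i {j. E i j}))" using assms(1) by (intro finite_PiE) auto
  thus ?thesis using bij_betw_finite[OF orientations_PiE_bij[of E V]] E by blast
qed

text \<open>A permutation along edges exchanges the moved vertices of the two sides of the bipartition, so
both sides have equally many.\<close>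

lemma even_card_moved:
  assumes V: "finite V" and p: "p permutes V" "p \<in> orientations E"
    and X: "\<And>i j. E i j \<Longrightarrow> i \<in> X \<longleftrightarrow> j \<notin> X"
  shows "even (card (moved p))"
proof -
  have inj: "inj p" using p(1) by (rule permutes_inj)
  have fin: "finite (moved p)"
    by (rule finite_subset[OF _ V]) (use permutes_not_in[OF p(1)] in \<open>auto simp: moved_def\<close>)
  have flip: "p i \<in> moved p \<and> (i \<in> X \<longleftrightarrow> p i \<notin> X)" if "i \<in> moved p" for i
    using that p(2) X[of i "p i"] injD[OF inj, of "p i" i] by (auto simp: moved_def orientations_def)
  have "card (moved p \<inter> X) = card (moved p - X)"
  proof (rule antisym)
    show "card (moved p \<inter> X) \<le> card (moved p - X)"
      using flip fin by (intro card_inj_on_le[of p] inj_on_subset[OF inj]) auto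
    show "card (moved p - X) \<le> card (moved p \<inter> X)"
      using flip fin by (intro card_inj_on_le[of p] inj_on_subset[OF inj]) auto
  qed
  moreover have "card (moved p) = card (moved p \<inter> X) + card (moved p - X)"
    using card_Int_Diff[OF fin, of X] by simp
  ultimately show ?thesis by simp
qed

text \<open>The contribution of the choice \<open>a\<close> made at vertex \<open>i\<close> to the entry in row \<open>i\<close> and column \<open>j\<close> of
\<open>x I - L\<close>. Being unoriented (\<open>a = i\<close>) accounts for \<open>x\<close>. Each neighbour \<open>a\<close> accounts for one
unit of the degree on the diagonal and for the off-diagonal entry \<open>1\<close> in its own column.\<close>

definition local_factor :: "'b \<Rightarrow> 'a \<Rightarrow> 'a \<Rightarrow> 'a \<Rightarrow> 'b :: comm_ring_1" where
  "local_factor x i a j =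
     (if a = i then if j = i then x else 0 else if j = i then - 1 else if j = a then 1 else 0)"

lemma sum_local_factor:
  assumes "finite {j. E i j}" "\<not> E i i"
  shows "(\<Sum>a\<in>insert i {j. E i j}. local_factor x i a j) =
      (if j = i then x - of_nat (card {j. E i j}) else if E i j then 1 else 0)"
proof -
  have "(\<Sum>a\<in>{j. E i j}. local_factor x i a j) =
      (\<Sum>a\<in>{j. E i j}. if j = i then - 1 else if a = j then 1 else 0)"
    using assms(2) by (intro sum.cong) (auto simp: local_factor_def)
  also have "\<dots> = (if j = i then - of_nat (card {j. E i j}) else if E i j then 1 else 0)"
    using assms(1) by simp
  finally show ?thesis using assms by (simp add: local_factor_def)
qed

text \<open>Every oriented vertex contributes \<open>-1\<close>, and every vertex moved by \<open>p\<close> takes this sign back.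
The latter are even in number, so that the sign depends on \<open>f\<close> only.\<close>

lemma prod_local_factor:
  fixes x :: "'b :: comm_ring_1"
  assumes V: "finite V" and f: "f \<in> orientations E" and E: "\<And>i j. E i j \<Longrightarrow> i \<in> V"
    and p: "p permutes V" and X: "\<And>i j. E i j \<Longrightarrow> i \<in> X \<longleftrightarrow> j \<notin> X"
  shows "(\<Prod>i\<in>V. local_factor x i (f i) (p i)) =
      (if p \<in> cycle_choices V f then (- 1) ^ card (moved f) * x ^ (card V - card (moved f)) else 0)"
proof (cases "p \<in> cycle_choices V f")
  case True
  hence pf: "p i = i \<or> p i = f i" for i by (auto simp: cycle_choices_def)
  have mf: "moved f \<subseteq> V" using f E by (auto simp: moved_def orientations_def)
  have mp: "moved p \<subseteq> V" using permutes_not_in[OF p] by (auto simp: moved_def)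
  have "p \<in> orientations E" using pf f by (auto simp: orientations_def) metis
  hence even: "even (card (moved p))" using even_card_moved[OF V p _ X] by blast
  have "(\<Prod>i\<in>V. local_factor x i (f i) (p i)) =
      (\<Prod>i\<in>V. (if i \<in> moved f then - 1 else x) * (if i \<in> moved p then - 1 else 1))"
  proof (intro prod.cong refl)
    fix i show "local_factor x i (f i) (p i) =
        (if i \<in> moved f then - 1 else x) * (if i \<in> moved p then - 1 else 1)"
      using pf[of i] by (auto simp: local_factor_def moved_def)
  qed
  also have "\<dots> = ((- 1) ^ card (moved f) * x ^ (card (V - moved f))) * (- 1) ^ card (moved p)"
    using V mf mp by (simp add: prod.distrib prod.If_cases Int_absorb1 Diff_eq)
  also have "card (V - moved f) = card V - card (moved f)"
    using mf V finite_subset by (intro card_Diff_subset) auto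
  finally show ?thesis using True even by simp
next
  case False
  then obtain i where i: "p i \<noteq> i" "p i \<noteq> f i" using p by (auto simp: cycle_choices_def)
  hence "i \<in> V" "local_factor x i (f i) (p i) = 0"
    using permutes_not_in[OF p] by (auto simp: local_factor_def)
  thus ?thesis using False V by (auto intro: prod_zero)
qed

lemma degree_eq_card:
  "out_degree (with_proj G) i = card {j. (i, j) \<in> parcs G}"
proof -
  have "out_arcs (with_proj G) i = Pair i ` {j. (i, j) \<in> parcs G}"
    by (auto simp: out_arcs_def)
  thus ?thesis by (simp add: out_degree_def card_image inj_on_def)
qed

text \<open>Writing each entry of \<open>x I - L\<close> as a sum of local factors and expanding the product over the
rows turns the immanant into a sum over pairs of a permutation and an orientation.\<close>

lemma imm_coeff_laplacian:
  assumes E: "\<And>i j. (i, j) \<in> parcs G \<Longrightarrow> i < n \<and> j < n"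
    and X: "\<And>i j. (i, j) \<in> parcs G \<Longrightarrow> i \<in> X \<longleftrightarrow> j \<notin> X"
    and r: "r \<le> n"
  shows "imm_coeff lam (laplacian n G) r =
    (\<Sum>f | f \<in> orientations (\<lambda>i j. (i, j) \<in> parcs G) \<and> card (moved f) = r.
       \<Sum>p\<in>cycle_choices {0..<n} f. irr_char lam p)"
proof -
  let ?V = "{0..<n}" and ?E = "\<lambda>i j. (i, j) \<in> parcs G"
  let ?O = "orientations ?E"
  define w where "w f = (\<Sum>p\<in>cycle_choices ?V f. irr_char lam p)" for f
  define P where "P = (\<Sum>f\<in>?O. monom ((- 1) ^ card (moved f) * w f) (n - card (moved f)))"
  have loop: "\<not> ?E i i" for i using X[of i i] by blast
  have fin_nb: "finite {j. ?E i j}" for i by (rule finite_subset[of _ ?V]) (auto dest: E)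
  have fin_O: "finite ?O" by (rule finite_orientations[of ?V]) (auto dest: E)
  have moved_le: "card (moved f) \<le> n" if "f \<in> ?O" for f
  proof -
    have "i < n" if "f i \<noteq> i" for i using that \<open>f \<in> ?O\<close> E[of i "f i"] by (auto simp: orientations_def)
    hence "moved f \<subseteq> ?V" by (auto simp: moved_def)
    thus ?thesis using card_mono[of ?V "moved f"] by simp
  qed
  have dim: "dim_row (laplacian n G) = n"
    by (simp add: laplacian_def degree_mat_def adjacency_mat_def)
  have poly_P: "poly P x = immanant lam (x \<cdot>\<^sub>m 1\<^sub>m n - laplacian n G)" for x
  proof -
    have entry: "(x \<cdot>\<^sub>m 1\<^sub>m n - laplacian n G) $$ (i, p i) =
        (\<Sum>a\<in>insert i {j. ?E i j}. local_factor x i a (p i))"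
      if "p permutes ?V" "i \<in> ?V" for p i
    proof -
      have "p i < n" using permutes_in_image[OF that(1), of i] that(2) by simp
      thus ?thesis
        using that(2) loop[of i] sum_local_factor[where E = ?E and x = x and j = "p i", OF fin_nb loop]
        by (auto simp: laplacian_def degree_mat_def adjacency_mat_def degree_eq_card)
    qed
    have prod_entry: "(\<Prod>i\<in>?V. (x \<cdot>\<^sub>m 1\<^sub>m n - laplacian n G) $$ (i, p i)) =
        (\<Sum>f\<in>?O. if p \<in> cycle_choices ?V f
            then (- 1) ^ card (moved f) * x ^ (n - card (moved f)) else 0)"
      if p: "p permutes ?V" for p
    proof -
      have "(\<Prod>i\<in>?V. (x \<cdot>\<^sub>m 1\<^sub>m n - laplacian n G) $$ (i, p i)) =
          (\<Prod>i\<in>?V. \<Sum>a\<in>insert i {j. ?E i j}. local_factor x i a (p i))"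
        using entry[OF p] by (intro prod.cong refl)
      also have "\<dots> = (\<Sum>g\<in>PiE ?V (\<lambda>i. insert i {j. ?E i j}). \<Prod>i\<in>?V. local_factor x i (g i) (p i))"
        using fin_nb by (intro prod_sum_PiE) auto
      also have "\<dots> = (\<Sum>f\<in>?O. \<Prod>i\<in>?V. local_factor x i (restrict f ?V i) (p i))"
        by (rule sum.reindex_bij_betw[symmetric], rule orientations_PiE_bij) (auto dest: E)
      also have "\<dots> = (\<Sum>f\<in>?O. if p \<in> cycle_choices ?V f
            then (- 1) ^ card (moved f) * x ^ (n - card (moved f)) else 0)"
      proof (intro sum.cong refl)
        fix f assume f: "f \<in> ?O"
        have "(\<Prod>i\<in>?V. local_factor x i (restrict f ?V i) (p i)) =
            (\<Prod>i\<in>?V. local_factor x i (f i) (p i))" by (intro prod.cong) auto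
        thus "(\<Prod>i\<in>?V. local_factor x i (restrict f ?V i) (p i)) =
            (if p \<in> cycle_choices ?V f
             then (- 1) ^ card (moved f) * x ^ (n - card (moved f)) else 0)"
          using prod_local_factor[OF _ f _ p X, of x] E by simp
      qed
      finally show ?thesis .
    qed
    have "immanant lam (x \<cdot>\<^sub>m 1\<^sub>m n - laplacian n G) =
        (\<Sum>p | p permutes ?V. \<Sum>f\<in>?O. if p \<in> cycle_choices ?V f
            then irr_char lam p * ((- 1) ^ card (moved f) * x ^ (n - card (moved f))) else 0)"
      unfolding immanant_def using dim
      by (auto simp: prod_entry sum_distrib_left if_distrib[of "\<lambda>y. _ * y"] cong: if_cong intro!: sum.cong)
    also have "\<dots> = (\<Sum>f\<in>?O. \<Sum>p | p permutes ?V. if p \<in> cycle_choices ?V f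
            then irr_char lam p * ((- 1) ^ card (moved f) * x ^ (n - card (moved f))) else 0)"
      by (rule sum.swap)
    also have "\<dots> = (\<Sum>f\<in>?O. w f * ((- 1) ^ card (moved f) * x ^ (n - card (moved f))))"
    proof (intro sum.cong refl)
      fix f
      have "{p. p permutes ?V} \<inter> cycle_choices ?V f = cycle_choices ?V f"
        by (auto simp: cycle_choices_def)
      thus "(\<Sum>p | p permutes ?V. if p \<in> cycle_choices ?V f
            then irr_char lam p * ((- 1) ^ card (moved f) * x ^ (n - card (moved f))) else 0) =
          w f * ((- 1) ^ card (moved f) * x ^ (n - card (moved f)))"
        by (simp add: sum.inter_restrict[symmetric] finite_permutations w_def sum_distrib_right)
    qed
    also have "\<dots> = poly P x"
      by (simp add: P_def poly_sum poly_monom mult_ac)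
    finally show ?thesis by simp
  qed
  have "immanantal_poly lam (laplacian n G) = P"
    unfolding immanantal_poly_def dim
  proof (rule the_equality)
    show "\<forall>x. poly P x = immanant lam (x \<cdot>\<^sub>m 1\<^sub>m n - laplacian n G)" using poly_P by blast
    fix Q assume "\<forall>x. poly Q x = immanant lam (x \<cdot>\<^sub>m 1\<^sub>m n - laplacian n G)"
    hence "poly Q = poly P" using poly_P by auto
    thus "Q = P" by (simp add: poly_eq_poly_eq_iff)
  qed
  hence "imm_coeff lam (laplacian n G) r = (- 1) ^ r * coeff P (n - r)"
    by (simp add: imm_coeff_def dim)
  also have "coeff P (n - r) =
      (\<Sum>f\<in>?O. if card (moved f) = r then (- 1) ^ r * w f else 0)"
    unfolding P_def coeff_sum using moved_le r by (intro sum.cong) force+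
  also have "\<dots> = (- 1) ^ r * (\<Sum>f | f \<in> ?O \<and> card (moved f) = r. w f)"
    using fin_O by (auto simp: sum.inter_filter sum_distrib_left intro!: sum.cong)
  finally show ?thesis by (simp add: w_def mult.assoc[symmetric] flip: power_mult_distrib)
qed

section \<open>The effect of a shift on orientations\<close>

text \<open>No cycle leaves an invariant set \<open>D\<close>, hence none enters it either: arcs that lead from outside
into \<open>D\<close> lie on no cycle and may be redirected within \<open>D\<close> freely.\<close>

lemma cycle_choices_cong_invariant:
  assumes V: "finite V" "D \<subseteq> V" and D: "f ` D \<subseteq> D"
    and eq: "\<And>i. g i = f i \<or> i \<notin> D \<and> f i \<in> D \<and> g i \<in> D"
  shows "cycle_choices V f = cycle_choices V g"
proof -
  have *: "cycle_choices V f \<subseteq> cycle_choices V g"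
    if D: "f ` D \<subseteq> D" and eq: "\<And>i. g i = f i \<or> i \<notin> D \<and> f i \<in> D \<and> g i \<in> D" for f g
  proof
    fix p assume p: "p \<in> cycle_choices V f"
    hence pV: "p permutes V" and pf: "p i = i \<or> p i = f i" for i by (auto simp: cycle_choices_def)
    have "p i \<in> D" if "i \<in> D" for i using pf[of i] D that by auto
    hence "p ` D \<subseteq> D" by blast
    hence "p i \<notin> D" if "i \<notin> D" for i using permutes_invariant_complement[OF pV V(1) V(2)] that by blast
    hence "p i = i \<or> p i = g i" for i using pf[of i] eq[of i] by metis
    thus "p \<in> cycle_choices V g" using pV by (auto simp: cycle_choices_def)
  qed
  have "g ` D \<subseteq> D" using D eq by (metis image_subset_iff)
  thus ?thesis using *[of f g] *[of g f] D eq by (metis subset_antisym)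
qed

lemma cycle_choices_conjugate:
  assumes t: "t permutes V"
  shows "cycle_choices V (t \<circ> f \<circ> inv t) = (\<lambda>p. t \<circ> p \<circ> inv t) ` cycle_choices V f"
proof -
  have *: "(\<lambda>p. t \<circ> p \<circ> inv t) ` cycle_choices V f \<subseteq> cycle_choices V (t \<circ> f \<circ> inv t)"
    if t: "t permutes V" for t and f :: "'a \<Rightarrow> 'a"
  proof safe
    fix p assume p: "p \<in> cycle_choices V f"
    have "t (p (inv t i)) = i \<or> t (p (inv t i)) = t (f (inv t i))" for i
    proof -
      have "p (inv t i) = inv t i \<or> p (inv t i) = f (inv t i)" using p by (auto simp: cycle_choices_def)
      thus ?thesis using permutes_inverses(1)[OF t, of i] by metis
    qed
    moreover have "t \<circ> p \<circ> inv t permutes V"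
      using p t by (auto simp: cycle_choices_def intro!: permutes_compose permutes_inv)
    ultimately show "t \<circ> p \<circ> inv t \<in> cycle_choices V (t \<circ> f \<circ> inv t)"
      by (simp add: cycle_choices_def)
  qed
  have cancel: "inv t \<circ> (t \<circ> p \<circ> inv t) \<circ> t = p" "t \<circ> (inv t \<circ> p \<circ> t) \<circ> inv t = p" for p
    using permutes_inverses[OF t] by (auto simp: fun_eq_iff)
  have "cycle_choices V (t \<circ> f \<circ> inv t) \<subseteq> (\<lambda>p. t \<circ> p \<circ> inv t) ` cycle_choices V f"
  proof
    fix p assume p: "p \<in> cycle_choices V (t \<circ> f \<circ> inv t)"
    have "inv t \<circ> p \<circ> t \<in> cycle_choices V f"
      using *[OF permutes_inv[OF t], of "t \<circ> f \<circ> inv t"] p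
      unfolding cancel inv_inv_eq[OF permutes_bij[OF t]] by auto
    thus "p \<in> (\<lambda>p. t \<circ> p \<circ> inv t) ` cycle_choices V f" using cancel(2)[of p] by (metis imageI)
  qed
  thus ?thesis using *[OF t] by blast
qed

lemma sum_cycle_choices_conjugate:
  assumes t: "t permutes V"
    and conj: "\<And>g t. g permutes V \<Longrightarrow> t permutes V \<Longrightarrow> chi (t \<circ> g \<circ> inv t) = chi g"
  shows "(\<Sum>p\<in>cycle_choices V (t \<circ> f \<circ> inv t). chi p) = (\<Sum>p\<in>cycle_choices V f. chi p)"
proof -
  have "inj_on (\<lambda>p. t \<circ> p \<circ> inv t) (cycle_choices V f)"
  proof (rule inj_on_inverseI)
    fix p show "inv t \<circ> (t \<circ> p \<circ> inv t) \<circ> t = p"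
      using permutes_inverses[OF t] by (auto simp: fun_eq_iff)
  qed
  thus ?thesis unfolding cycle_choices_conjugate[OF t]
    by (subst sum.reindex) (auto simp: cycle_choices_def conj[OF _ t] intro!: sum.cong)
qed

text \<open>The structure behind a generalized graph shift with recipient \<open>u\<close> and donor \<open>w\<close>. The set \<open>Q\<close>
consists of the vertices of the path and \<open>rho\<close> reverses the path. \<open>Z\<close> contains the neighbours
that are moved from \<open>w\<close> to \<open>u\<close>, and \<open>B\<close> is the part of the graph that hangs at \<open>w\<close>. The remaining
vertices, outside \<open>B \<union> Q\<close>, hang at \<open>u\<close> as far as they touch the path at all.\<close>

locale path_shift =
  fixes V :: "'a set" and E1 E2 :: "'a \<Rightarrow> 'a \<Rightarrow> bool"
    and u w :: 'a and Q B Z :: "'a set" and rho :: "'a \<Rightarrow> 'a"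
  assumes finite_V: "finite V"
    and E1_V: "E1 i j \<Longrightarrow> i \<in> V \<and> j \<in> V"
    and sym: "E1 i j \<Longrightarrow> E1 j i"
    and E2_iff: "E2 i j \<longleftrightarrow>
      E1 i j \<and> \<not> (i = w \<and> j \<in> Z) \<and> \<not> (i \<in> Z \<and> j = w) \<or> i = u \<and> j \<in> Z \<or> i \<in> Z \<and> j = u"
    and uw: "u \<noteq> w" "u \<in> Q" "w \<in> Q" and Q: "Q \<subseteq> V" "Q \<inter> B = {}" and ZB: "Z \<subseteq> B" "B \<subseteq> V"
    and Z: "z \<in> Z \<Longrightarrow> E1 w z"
    and w_nb: "E1 w y \<Longrightarrow> y \<in> Z \<or> y \<in> Q"
    and B_nb: "x \<in> B \<Longrightarrow> E1 x y \<Longrightarrow> y \<in> B \<or> y = w \<and> x \<in> Z"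
    and interior_nb: "x \<in> Q \<Longrightarrow> x \<noteq> u \<Longrightarrow> x \<noteq> w \<Longrightarrow> E1 x y \<Longrightarrow> y \<in> Q"
    and rho: "rho permutes Q" "rho (rho x) = x" "rho u = w"
    and rho_edge: "x \<in> Q \<Longrightarrow> y \<in> Q \<Longrightarrow> E1 x y \<Longrightarrow> E1 (rho x) (rho y)"
begin

text \<open>An orientation of the shifted graph is turned into one of the original graph. If \<open>u\<close> is not
oriented towards a moved neighbour, then only the arcs from \<open>Z\<close> to \<open>u\<close> have to be changed; they
lead to \<open>w\<close> instead and lie on no cycle. Otherwise the choice made at \<open>u\<close> has to be made at \<open>w\<close>,
and therefore everything on the path is reversed.\<close>

definition redirect :: "('a \<Rightarrow> 'a) \<Rightarrow> 'a \<Rightarrow> 'a" where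
  "redirect f = (\<lambda>i. if i \<in> B \<and> f i = u then w else f i)"

text \<open>Outside \<open>B \<union> Q\<close> the arcs to \<open>u\<close> are kept, although conjugation by \<open>rho\<close> would turn them into arcs
to \<open>w\<close>, which are no edges. In the case where this map is used, no cycle passes through them.\<close>

definition reflect :: "('a \<Rightarrow> 'a) \<Rightarrow> 'a \<Rightarrow> 'a" where
  "reflect f = (\<lambda>i. if i \<in> B \<union> Q then rho (f (rho i)) else f i)"

definition pull_back :: "('a \<Rightarrow> 'a) \<Rightarrow> 'a \<Rightarrow> 'a" where
  "pull_back f = (if f u \<in> Z then reflect f else redirect f)"

lemma rho_off: "x \<notin> Q \<Longrightarrow> rho x = x"
  using rho(1) by (rule permutes_not_in)

lemma rho_B: "x \<in> B \<Longrightarrow> rho x = x"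
  using rho_off Q(2) by blast

lemma rho_Q: "rho x \<in> Q \<longleftrightarrow> x \<in> Q"
  using rho(1) by (rule permutes_in_image)

lemma rho_w: "rho w = u"
  using rho(2)[of u] rho(3) by simp

lemma notin: "u \<notin> B" "w \<notin> B" "u \<notin> Z" "w \<notin> Z"
  using uw Q(2) ZB by auto

context
  fixes f assumes f: "f \<in> orientations E2"
begin

lemma arc: "f i \<noteq> i \<Longrightarrow> E2 i (f i)"
  using f by (auto simp: orientations_def)

lemma arc_from_B: "i \<in> B \<Longrightarrow> f i \<in> B \<or> f i = u \<and> i \<in> Z"
  using arc[of i] B_nb[of i "f i"] notin unfolding E2_iff by metis

lemma arc_from_B_unmoved: "i \<in> B \<Longrightarrow> f i \<noteq> u \<Longrightarrow> f i \<noteq> i \<Longrightarrow> E1 i (f i)"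
  using arc[of i] notin unfolding E2_iff by metis

lemma arc_from_path:
  assumes "i \<in> Q" "i \<noteq> u"
  shows "f i \<in> Q" "f i \<noteq> i \<Longrightarrow> E1 i (f i)"
proof -
  have "i \<notin> B" "i \<notin> Z" using assms Q(2) ZB by auto
  thus "f i \<noteq> i \<Longrightarrow> E1 i (f i)" using arc[of i] assms(2) unfolding E2_iff by metis
  show "f i \<in> Q"
    using arc[of i] assms w_nb[of "f i"] interior_nb[of i "f i"] \<open>i \<notin> Z\<close> unfolding E2_iff by metis
qed

lemma arc_from_u: "f u \<noteq> u \<Longrightarrow> f u \<notin> Z \<Longrightarrow> E1 u (f u) \<and> f u \<notin> B"
  using arc[of u] B_nb[of "f u" u] sym[of u "f u"] notin uw(1) unfolding E2_iff by metis

lemma arc_from_rest: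
  assumes "i \<notin> B \<union> Q"
  shows "f i \<notin> B \<union> Q \<or> f i = u" "f i \<noteq> i \<Longrightarrow> E1 i (f i)"
proof -
  have i: "i \<noteq> u" "i \<noteq> w" "i \<notin> Z" "i \<notin> B" "i \<notin> Q" using assms uw ZB by auto
  show E1: "f i \<noteq> i \<Longrightarrow> E1 i (f i)" using arc[of i] i unfolding E2_iff by metis
  show "f i \<notin> B \<union> Q \<or> f i = u"
  proof (cases "f i = i")
    case False
    hence "E1 (f i) i" using E1 sym by blast
    thus ?thesis using B_nb[of "f i" i] interior_nb[of "f i" i] w_nb[of i] i by blast
  qed (use assms in simp)
qed

lemma pull_back_orientation: "pull_back f \<in> orientations E1"
proof (cases "f u \<in> Z")
  case False
  have "redirect f i = i \<or> E1 i (redirect f i)" for i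
  proof -
    consider "i \<in> B" | "i \<in> Q" "i \<noteq> u" | "i = u" | "i \<notin> B \<union> Q" by blast
    thus ?thesis
    proof cases
      case 1
      consider "f i \<in> B" "f i \<noteq> u" | "f i = u" "i \<in> Z" using arc_from_B[OF 1] notin(1) by metis
      thus ?thesis
      proof cases
        case a: 1
        hence "redirect f i = f i" using 1 by (simp add: redirect_def)
        thus ?thesis using arc_from_B_unmoved[OF 1 a(2)] by auto
      next
        case 2
        hence "redirect f i = w" using 1 by (simp add: redirect_def)
        thus ?thesis using sym[OF Z[OF 2(2)]] by simp
      qed
    next
      case 2
      thus ?thesis using arc_from_path(2)[of i] Q(2) by (auto simp: redirect_def)
    next
      case 3
      thus ?thesis using arc_from_u False notin by (auto simp: redirect_def)
    next
      case 4
      thus ?thesis using arc_from_rest(2)[of i] by (auto simp: redirect_def)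
    qed
  qed
  thus ?thesis using False by (auto simp: pull_back_def orientations_def)
next
  case True
  have "reflect f i = i \<or> E1 i (reflect f i)" for i
  proof -
    consider "i \<in> B" | "i = w" | "i \<in> Q" "i \<noteq> w" | "i \<notin> B \<union> Q" by blast
    thus ?thesis
    proof cases
      case 1
      consider "f i \<in> B" "f i \<noteq> u" | "f i = u" "i \<in> Z" using arc_from_B[OF 1] notin(1) by metis
      thus ?thesis
      proof cases
        case a: 1
        hence "reflect f i = f i" using 1 by (simp add: reflect_def rho_B rho(3))
        thus ?thesis using arc_from_B_unmoved[OF 1 a(2)] by auto
      next
        case 2
        hence "reflect f i = w" using 1 by (simp add: reflect_def rho_B rho(3))
        thus ?thesis using sym[OF Z[OF 2(2)]] by simp
      qed
    next
      case 2
      thus ?thesis using True Z uw ZB by (auto simp: reflect_def rho_w rho_B)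
    next
      case 3
      hence r: "rho i \<in> Q" "rho i \<noteq> u" using rho_Q rho(2)[of i] rho(3) by auto
      show ?thesis
      proof (cases "f (rho i) = rho i")
        case False
        thus ?thesis
          using rho_edge[OF r(1) arc_from_path(1)[OF r] arc_from_path(2)[OF r]] 3
          by (simp add: reflect_def rho(2))
      qed (use 3 in \<open>simp add: reflect_def rho(2)\<close>)
    next
      case 4
      thus ?thesis using arc_from_rest(2)[of i] by (auto simp: reflect_def)
    qed
  qed
  thus ?thesis using True by (auto simp: pull_back_def orientations_def)
qed

lemma card_moved_pull_back: "card (moved (pull_back f)) = card (moved f)"
proof (cases "f u \<in> Z")
  case False
  hence "moved (pull_back f) = moved f"
    using notin by (auto simp: moved_def pull_back_def redirect_def)
  thus ?thesis by simp
next
  case True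
  have inj: "inj rho" using rho(1) by (rule permutes_inj)
  have "pull_back f (rho i) = rho i \<longleftrightarrow> f i = i" for i
    using True rho_off[of i] injD[OF inj, of "f i" i] rho_Q[of i] rho_B[of i]
    by (auto simp: pull_back_def reflect_def rho(2))
  hence "moved (pull_back f) = rho ` moved f"
    unfolding moved_def by (auto simp: image_iff) (metis rho(2))
  thus ?thesis using inj by (simp add: card_image inj_on_subset[OF inj])
qed

text \<open>In the first case both orientations have the same cycles, as \<open>V - B\<close> is invariant; in the second
case \<open>B \<union> Q\<close> is invariant and the cycles correspond under conjugation by \<open>rho\<close>.\<close>

lemma sum_cycle_choices_pull_back:
  assumes conj: "\<And>g t. g permutes V \<Longrightarrow> t permutes V \<Longrightarrow> chi (t \<circ> g \<circ> inv t) = chi g"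
  shows "(\<Sum>p\<in>cycle_choices V (pull_back f). chi p) = (\<Sum>p\<in>cycle_choices V f. chi p)"
proof (cases "f u \<in> Z")
  case False
  have "f i \<notin> B" if "i \<in> V - B" for i
  proof -
    consider "i \<in> Q" "i \<noteq> u" | "i = u" | "i \<notin> B \<union> Q" using \<open>i \<in> V - B\<close> by blast
    thus ?thesis
    proof cases
      case 1
      thus ?thesis using arc_from_path(1)[of i] Q(2) by auto
    next
      case 2
      thus ?thesis using arc_from_u False notin by metis
    next
      case 3
      thus ?thesis using arc_from_rest(1)[of i] notin by auto
    qed
  qed
  moreover have "f i \<in> V" if "i \<in> V" for i
    using arc[of i] E1_V[of i "f i"] that uw Q ZB unfolding E2_iff by (metis subsetD)
  ultimately have D: "f ` (V - B) \<subseteq> V - B" by blast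
  have "cycle_choices V f = cycle_choices V (redirect f)"
    by (rule cycle_choices_cong_invariant[OF finite_V _ D])
      (use uw Q notin in \<open>auto simp: redirect_def\<close>)
  thus ?thesis using False by (simp add: pull_back_def)
next
  case True
  define g where "g = (\<lambda>i. if i \<notin> B \<union> Q \<and> f i = u then w else f i)"
  have inv_rho: "inv rho = rho" using rho(2) by (intro inv_unique_comp) auto
  have rV: "rho permutes V" using rho(1) Q(1) by (rule permutes_subset)
  have "f i \<in> B \<union> Q" if "i \<in> B \<union> Q" for i
    using that arc_from_B[of i] arc_from_path(1)[of i] True ZB uw by (cases "i = u") auto
  hence D: "f ` (B \<union> Q) \<subseteq> B \<union> Q" by blast
  have eq: "cycle_choices V f = cycle_choices V g"
    by (rule cycle_choices_cong_invariant[OF finite_V _ D])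
      (use uw Q ZB in \<open>auto simp: g_def\<close>)
  have "reflect f i = (rho \<circ> g \<circ> inv rho) i" for i
  proof (cases "i \<in> B \<union> Q")
    case True
    hence "rho i \<in> B \<union> Q" using rho_Q rho_B by auto
    thus ?thesis using True by (auto simp: reflect_def g_def inv_rho)
  next
    case False
    thus ?thesis using arc_from_rest(1)[of i] rho_off[of i] rho_off[of "f i"]
      by (auto simp: reflect_def g_def inv_rho rho_w)
  qed
  hence "pull_back f = rho \<circ> g \<circ> inv rho" using True by (auto simp: pull_back_def)
  moreover have "(\<Sum>p\<in>cycle_choices V (rho \<circ> g \<circ> inv rho). chi p) = (\<Sum>p\<in>cycle_choices V g. chi p)"
    by (rule sum_cycle_choices_conjugate[OF rV conj])
  ultimately show ?thesis by (simp only: eq)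
qed

text \<open>The two cases remain distinguishable in the image: reflection orients \<open>w\<close> towards \<open>Z\<close>,
whereas in the shifted graph \<open>w\<close> is not adjacent to \<open>Z\<close> and redirection leaves the choice at \<open>w\<close> alone.\<close>

lemma pull_back_case: "pull_back f w \<in> Z \<longleftrightarrow> f u \<in> Z"
proof (cases "f u \<in> Z")
  case True
  thus ?thesis using uw rho_B ZB by (auto simp: pull_back_def reflect_def rho_w)
next
  case False
  have "f w \<notin> Z" using arc_from_path(1)[of w] uw Q(2) ZB by auto
  thus ?thesis using False notin by (auto simp: pull_back_def redirect_def)
qed

lemma pull_back_recover:
  "f i = (if pull_back f w \<in> Z then if i \<in> B \<union> Q then rho (pull_back f (rho i)) else pull_back f i
     else if i \<in> B \<and> pull_back f i = w then u else pull_back f i)"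
proof (cases "f u \<in> Z")
  case True
  have "rho i \<in> B \<union> Q" if "i \<in> B \<union> Q" using rho_Q rho_B that by auto
  thus ?thesis unfolding pull_back_case using True by (auto simp: pull_back_def reflect_def rho(2))
next
  case False
  thus ?thesis unfolding pull_back_case using arc_from_B[of i] notin
    by (auto simp: pull_back_def redirect_def)
qed

end

lemma inj_on_pull_back: "inj_on pull_back (orientations E2)"
proof (rule inj_onI)
  fix f g assume "f \<in> orientations E2" "g \<in> orientations E2" "pull_back f = pull_back g"
  thus "f = g" using pull_back_recover[of f] pull_back_recover[of g] by (intro ext) metis
qed

text \<open>The orientations of the original graph outside the image of \<open>pull_back\<close>
only add nonnegative terms.\<close>

lemma sum_orientations_le:
  fixes chi :: "('a \<Rightarrow> 'a) \<Rightarrow> complex"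
  assumes conj: "\<And>g t. g permutes V \<Longrightarrow> t permutes V \<Longrightarrow> chi (t \<circ> g \<circ> inv t) = chi g"
    and nonneg: "\<And>f. (\<Sum>p\<in>cycle_choices V f. chi p) \<ge> 0"
  shows "(\<Sum>f | f \<in> orientations E2 \<and> card (moved f) = r. \<Sum>p\<in>cycle_choices V f. chi p)
    \<le> (\<Sum>f | f \<in> orientations E1 \<and> card (moved f) = r. \<Sum>p\<in>cycle_choices V f. chi p)"
proof -
  let ?w = "\<lambda>f. \<Sum>p\<in>cycle_choices V f. chi p"
  let ?O1 = "{f \<in> orientations E1. card (moved f) = r}" and ?O2 = "{f \<in> orientations E2. card (moved f) = r}"
  have "(\<Sum>f\<in>?O2. ?w f) = (\<Sum>f\<in>?O2. ?w (pull_back f))"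
  proof (rule sum.cong[OF refl])
    fix f assume "f \<in> ?O2"
    hence "f \<in> orientations E2" by simp
    thus "?w f = ?w (pull_back f)" using sum_cycle_choices_pull_back[OF _ conj] by metis
  qed
  also have "\<dots> = (\<Sum>f\<in>pull_back ` ?O2. ?w f)"
    by (rule sum.reindex_cong[OF inj_on_subset[OF inj_on_pull_back], symmetric]) auto
  also have "\<dots> \<le> (\<Sum>f\<in>?O1. ?w f)"
  proof (rule sum_mono2)
    show "finite ?O1" using finite_orientations[OF finite_V E1_V] by simp
    show "pull_back ` ?O2 \<subseteq> ?O1" using pull_back_orientation card_moved_pull_back by auto
  qed (rule nonneg)
  finally show ?thesis .
qed

end

section \<open>The structure of a generalized graph shift\<close>

lemma pawalk_verts_nth:
  assumes "pcas u P w" "i < length P"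
  shows "P ! i = (pawalk_verts u P ! i, pawalk_verts u P ! Suc i)"
  using assms
proof (induction P arbitrary: u i)
  case (Cons e P)
  thus ?case
  proof (cases i)
    case 0
    have "pawalk_verts (snd e) P ! 0 = snd e" using Cons.prems(1) by (cases P) auto
    thus ?thesis using Cons.prems 0 by (cases e) auto
  qed auto
qed simp

lemma pawalk_verts_ends:
  "pcas u P w \<Longrightarrow> length (pawalk_verts u P) = Suc (length P)"
  "pcas u P w \<Longrightarrow> pawalk_verts u P ! 0 = u"
  "pcas u P w \<Longrightarrow> pawalk_verts u P ! length P = w"
  by (induction P arbitrary: u) auto

lemma reversal_exists:
  assumes "distinct xs"
  obtains rho where "rho permutes set xs" "\<And>x. rho (rho x) = x"
    "\<And>i. i < length xs \<Longrightarrow> rho (xs ! i) = xs ! (length xs - Suc i)"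
proof -
  define rho where "rho x = (case map_of (zip xs (rev xs)) x of None \<Rightarrow> x | Some y \<Rightarrow> y)" for x
  have nth: "rho (xs ! i) = xs ! (length xs - Suc i)" if "i < length xs" for i
    using map_of_zip_nth[of xs "rev xs" i] assms that by (simp add: rho_def rev_nth)
  have off: "rho x = x" if "x \<notin> set xs" for x
  proof -
    have "map_of (zip xs (rev xs)) x = None" using that by (simp add: map_of_zip_is_None)
    thus ?thesis unfolding rho_def by (simp only: option.case)
  qed
  have invol: "rho (rho x) = x" for x
  proof (cases "x \<in> set xs")
    case True
    then obtain i where i: "i < length xs" "x = xs ! i" by (auto simp: in_set_conv_nth)
    have "rho (xs ! (length xs - Suc i)) = xs ! i" using nth[of "length xs - Suc i"] i(1) by simp
    thus ?thesis using nth[OF i(1)] i(2) by simp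
  qed (simp add: off)
  hence "\<exists>!x. rho x = y" for y by metis
  hence "rho permutes set xs" using off by (auto simp: permutes_def)
  thus ?thesis using that invol nth by blast
qed

text \<open>Let \<open>R\<close> be the set of vertices reachable from \<open>w\<close> without using an edge of the path. Inner
vertices of the path have degree two, so that all their edges belong to the path and they are
not in \<open>R\<close>. If \<open>u\<close> were in \<open>R\<close>, then a simple path from \<open>w\<close> to \<open>u\<close> inside \<open>R\<close> would close the
given path to a cycle through \<open>u\<close> and \<open>w\<close>. Thus \<open>R\<close> meets the path in \<open>w\<close> only, and \<open>R - {w}\<close> is
the part of the graph that hangs at \<open>w\<close>.\<close>

lemma ggs_path_shift:
  fixes G1 G2 :: "'a pair_pre_digraph"
  assumes graph: "pair_graph G1" and shift: "ggs G1 G2"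
  shows "\<exists>u w Q B Z rho. path_shift (pverts G1) (\<lambda>i j. (i, j) \<in> parcs G1)
    (\<lambda>i j. (i, j) \<in> parcs G2) u w Q B Z rho"
proof -
  interpret G: pair_graph G1 by (rule graph)
  obtain u w P where uw: "u \<noteq> w" and path: "G.apath u P w"
    and deg: "\<And>x. x \<in> set (pawalk_verts u P) - {u, w} \<Longrightarrow> out_degree (with_proj G1) x = 2"
    and acyclic: "\<not> (\<exists>c. graph_cycle G1 c \<and> u \<in> fst ` set c \<and> w \<in> fst ` set c)"
    and G2: "G2 = move_neighbours G1 u w (fst (last P))"
    using shift unfolding ggs_def by blast
  let ?E = "\<lambda>i j. (i, j) \<in> parcs G1"
  define vs where "vs = pawalk_verts u P"
  define m where "m = length P"
  have walk: "G.awalk u P w" and dist: "distinct vs" using path by (auto simp: G.apath_def vs_def)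
  have cas: "pcas u P w" and arcs: "set P \<subseteq> parcs G1" and "u \<in> pverts G1"
    using walk by (auto simp: G.awalk_def)
  have len: "length vs = Suc m" and vs_u: "vs ! 0 = u" and vs_w: "vs ! m = w"
    using pawalk_verts_ends[OF cas] by (auto simp: vs_def m_def)
  have m0: "m > 0" using vs_u vs_w uw by (cases m) auto
  have P_nth: "P ! i = (vs ! i, vs ! Suc i)" if "i < m" for i
    using pawalk_verts_nth[OF cas, of i] that by (simp add: vs_def m_def)
  have vs_eq: "vs ! i = vs ! j \<longleftrightarrow> i = j" if "i \<le> m" "j \<le> m" for i j
    using nth_eq_iff_index_eq[OF dist] that len by simp
  have set_P: "e \<in> set P \<longleftrightarrow> (\<exists>i<m. e = (vs ! i, vs ! Suc i))" for e
    by (auto simp: in_set_conv_nth m_def[symmetric] P_nth)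
  have set_vs: "x \<in> set vs \<longleftrightarrow> (\<exists>i\<le>m. x = vs ! i)" for x
    by (auto simp: in_set_conv_nth len less_Suc_eq_le)
  have w': "fst (last P) = vs ! (m - 1)"
    using m0 P_nth[of "m - 1"] by (subst last_conv_nth) (auto simp: m_def)
  have w'_vs: "fst (last P) \<in> set vs" unfolding w' set_vs using diff_le_self by blast
  have sym: "?E i j \<Longrightarrow> ?E j i" for i j by (rule G.arcs_symmetric)
  have step: "?E (vs ! i) (vs ! Suc i)" "?E (vs ! Suc i) (vs ! i)" if "i < m" for i
    using that arcs set_P sym by blast+

  define PE where "PE = set P \<union> (set P)\<inverse>"
  define R where "R = {x. \<exists>p. G.awalk w p x \<and> set p \<inter> PE = {}}"
  have PE_vs: "x \<in> set vs \<and> y \<in> set vs" if "(x, y) \<in> PE" for x y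
    using that unfolding PE_def set_P set_vs converse_iff Un_iff
    by (metis Suc_leI less_imp_le prod.inject)
  have PE_I: "(vs ! i, vs ! Suc i) \<in> PE" "(vs ! Suc i, vs ! i) \<in> PE" if "i < m" for i
    using that set_P by (auto simp: PE_def)
  have wR: "w \<in> R"
    using G.awalk_last_in_verts[OF walk] unfolding R_def
    by (auto intro!: exI[of _ "[]"] simp: G.awalk_Nil_iff)
  have R_step: "y \<in> R" if x: "x \<in> R" and xy: "?E x y" "(x, y) \<notin> PE" for x y
  proof -
    obtain p where p: "G.awalk w p x" "set p \<inter> PE = {}" using x by (auto simp: R_def)
    have "G.awalk x [(x, y)] y" using G.arc_implies_awalk[OF xy(1)] by simp
    hence "G.awalk w (p @ [(x, y)]) y" using p(1) G.awalk_appendI by blast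
    thus ?thesis using p(2) xy(2) by (auto simp: R_def intro!: exI[of _ "p @ [(x, y)]"])
  qed
  have R_last: "\<exists>y. ?E y x \<and> (y, x) \<notin> PE" if x: "x \<in> R" "x \<noteq> w" for x
  proof -
    obtain p where p: "G.awalk w p x" "set p \<inter> PE = {}" using x(1) by (auto simp: R_def)
    hence "p \<noteq> []" using x(2) by (auto simp: G.awalk_Nil_iff)
    then obtain q y z where q: "p = q @ [(y, z)]" by (metis append_butlast_last_id prod.exhaust)
    hence "z = x" using p(1) by (auto simp: G.awalk_Cons_iff G.awalk_Nil_iff)
    thus ?thesis using p q by (auto simp: G.awalk_Cons_iff)
  qed

  have inner_nb: "?E (vs ! i) y \<Longrightarrow> y = vs ! (i - 1) \<or> y = vs ! Suc i" if i: "0 < i" "i < m" for i y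
  proof -
    assume y: "?E (vs ! i) y"
    have "vs ! i \<in> set vs - {u, w}"
      using i vs_eq[of i 0] vs_eq[of i m] vs_u vs_w len by auto
    hence "card {j. ?E (vs ! i) j} = 2"
      using deg[of "vs ! i"] by (simp add: vs_def degree_eq_card)
    moreover have "{vs ! (i - 1), vs ! Suc i} \<subseteq> {j. ?E (vs ! i) j}"
      using step(1)[of i] step(2)[of "i - 1"] i by auto
    moreover have "card {vs ! (i - 1), vs ! Suc i} = 2"
      using vs_eq[of "i - 1" "Suc i"] i by auto
    moreover from \<open>card {j. ?E (vs ! i) j} = 2\<close> have "finite {j. ?E (vs ! i) j}"
      by (metis card.infinite zero_neq_numeral)
    ultimately have "{vs ! (i - 1), vs ! Suc i} = {j. ?E (vs ! i) j}"
      by (intro card_subset_eq) auto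
    thus ?thesis using y by blast
  qed
  have inner_PE: "(vs ! i, y) \<in> PE \<and> (y, vs ! i) \<in> PE" if "0 < i" "i < m" "?E (vs ! i) y" for i y
    using inner_nb[OF that] PE_I[of i] PE_I[of "i - 1"] that by auto
  have inner_R: "vs ! i \<notin> R" if "0 < i" "i < m" for i
  proof
    assume "vs ! i \<in> R"
    moreover have "vs ! i \<noteq> w" using vs_eq[of i m] that vs_w by auto
    ultimately obtain y where "?E y (vs ! i)" "(y, vs ! i) \<notin> PE" using R_last by blast
    thus False using inner_PE[OF that] sym by blast
  qed
  have uR: "u \<notin> R"
  proof
    assume "u \<in> R"
    then obtain p where p: "G.awalk w p u" "set p \<inter> PE = {}" by (auto simp: R_def)
    define q where "q = G.awalk_to_apath p"
    have q: "G.apath w q u" "set q \<inter> PE = {}"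
      using G.apath_awalk_to_apath[OF p(1)] G.awalk_to_apath_subset[OF p(1)] p(2)
      by (auto simp: q_def)
    have q_walk: "G.awalk w q u" and q_dist: "distinct (pawalk_verts w q)"
      using q(1) by (auto simp: G.apath_def)
    have q_R: "x \<in> R" if x: "x \<in> set (pawalk_verts w q)" for x
    proof -
      obtain q1 q2 where "q = q1 @ q2" "G.awalk w q1 x" using G.awalk_decomp[OF q_walk x] by blast
      thus ?thesis using q(2) by (auto simp: R_def)
    qed
    have q_ne: "q \<noteq> []" using q_walk uw by (auto simp: G.awalk_Nil_iff)
    have c_walk: "G.awalk u (P @ q) u" using walk q_walk by (rule G.awalk_appendI)
    have verts: "pawalk_verts u (P @ q) = vs @ tl (pawalk_verts w q)"
      using G.awalk_verts_append[OF c_walk] walk by (simp add: vs_def)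
    obtain vs' where vs': "vs = u # vs'" using vs_u len by (cases vs) auto
    obtain qs where qs: "pawalk_verts w q = w # qs"
      using q_ne q_walk by (cases q) (auto simp: G.awalk_Cons_iff)
    \<comment> \<open>The two paths meet only in \<open>u\<close> and \<open>w\<close>; \<open>vs'\<close> omits \<open>u\<close> and \<open>qs\<close> omits \<open>w\<close>.\<close>
    have "x \<notin> set qs" if x: "x \<in> set vs'" for x
    proof
      assume "x \<in> set qs"
      hence "x \<in> R" "x \<noteq> w" using q_R qs q_dist by auto
      moreover have "x \<in> set vs" "x \<noteq> u" using x vs' dist by auto
      then obtain i where "i \<le> m" "x = vs ! i" "i \<noteq> 0" using set_vs vs_u by metis
      ultimately show False using inner_R[of i] vs_w by (cases "i = m") auto
    qed
    hence "distinct (vs' @ qs)" using dist vs' q_dist qs by auto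
    hence "distinct (tl (pawalk_verts u (P @ q)))" by (simp add: verts vs' qs)
    hence "G.cycle (P @ q)" using c_walk q_ne unfolding G.cycle_def by blast
    \<comment> \<open>Two paths of length one would be the same edge, which the second path avoids.\<close>
    moreover have "length (P @ q) \<ge> 3"
    proof (rule ccontr)
      assume "\<not> length (P @ q) \<ge> 3"
      moreover have "length q \<noteq> 0" using q_ne by simp
      ultimately have l: "m = 1" "length q = 1"
        using m0 unfolding m_def length_append by linarith+
      hence "q = [(w, u)]"
        using q_walk by (cases q) (auto simp: G.awalk_Cons_iff G.awalk_Nil_iff)
      moreover have "(w, u) \<in> PE" using PE_I(2)[of 0] l vs_u vs_w by simp
      ultimately show False using q(2) by auto
    qed
    ultimately have "graph_cycle G1 (P @ q)" by (simp add: graph_cycle_def)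
    moreover have "u \<in> fst ` set (P @ q)" using P_nth[of 0] m0 vs_u
      by (force simp: m_def image_iff in_set_conv_nth)
    moreover have "w \<in> fst ` set (P @ q)"
      using q_ne q_walk by (cases q) (auto simp: G.awalk_Cons_iff)
    ultimately show False using acyclic by blast
  qed
  have vs_R: "x = w" if x: "x \<in> set vs" "x \<in> R" for x
  proof -
    obtain i where i: "i \<le> m" "x = vs ! i" using x(1) set_vs by blast
    thus ?thesis using inner_R[of i] uR x(2) vs_u vs_w by (cases "i = 0"; cases "i = m") auto
  qed

  have path_nb: "i = Suc j \<or> j = Suc i" if ij: "i \<le> m" "j \<le> m" and E: "?E (vs ! i) (vs ! j)" for i j
  proof -
    have inner: "i = Suc j \<or> j = Suc i" if "0 < i" "i < m" "j \<le> m" "?E (vs ! i) (vs ! j)" for i j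
      using inner_nb[OF that(1,2,4)] vs_eq[of j "i - 1"] vs_eq[of j "Suc i"] that by auto
    \<comment> \<open>A chord between the ends would put \<open>u\<close> into \<open>R\<close>.\<close>
    have ends: "\<not> ?E w u" if "m \<noteq> 1"
    proof
      assume "?E w u"
      moreover have "(w, u) \<notin> PE"
      proof
        assume "(w, u) \<in> PE"
        then obtain i where "i < m" "vs ! m = vs ! i \<and> vs ! 0 = vs ! Suc i \<or> vs ! 0 = vs ! i \<and> vs ! m = vs ! Suc i"
          unfolding PE_def Un_iff converse_iff set_P vs_u vs_w by auto
        thus False using vs_eq[of m i] vs_eq[of 0 i] vs_eq[of m "Suc i"] \<open>m \<noteq> 1\<close> by auto
      qed
      ultimately show False using R_step[OF wR] uR by blast
    qed
    have "i \<noteq> j" using E G.no_loops' by metis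
    then consider "0 < i" "i < m" | "0 < j" "j < m" | "i = 0" "j = m" | "i = m" "j = 0"
      using ij by linarith
    thus ?thesis
    proof cases
      case 1
      thus ?thesis using inner ij E by blast
    next
      case 2
      thus ?thesis using inner[of j i] ij sym[OF E] by blast
    next
      case 3
      hence "?E w u" using sym[OF E] vs_u vs_w by simp
      thus ?thesis using ends 3 by auto
    next
      case 4
      hence "?E w u" using E vs_u vs_w by simp
      thus ?thesis using ends 4 by auto
    qed
  qed

  obtain rho where rho: "rho permutes set vs" "\<And>x. rho (rho x) = x"
    "\<And>i. i \<le> m \<Longrightarrow> rho (vs ! i) = vs ! (m - i)"
    using reversal_exists[OF dist] len by (metis diff_Suc_Suc less_Suc_eq_le)

  define Z where "Z = {z. ?E w z \<and> z \<noteq> fst (last P)}"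
  have Z_R: "z \<in> R" if "z \<in> Z" for z
  proof (rule R_step[OF wR])
    show "?E w z" using that by (simp add: Z_def)
    show "(w, z) \<notin> PE"
    proof
      assume "(w, z) \<in> PE"
      then obtain i where "i < m" "vs ! m = vs ! i \<and> z = vs ! Suc i \<or> z = vs ! i \<and> vs ! m = vs ! Suc i"
        unfolding PE_def Un_iff converse_iff set_P vs_w by auto
      hence "m = Suc i" "z = vs ! i" using vs_eq[of m i] vs_eq[of m "Suc i"] by auto
      thus False using that w' by (simp add: Z_def)
    qed
  qed
  have "path_shift (pverts G1) ?E (\<lambda>i j. (i, j) \<in> parcs G2) u w (set vs) (R - {w}) Z rho"
  proof
    show "finite (pverts G1)" by (rule G.pair_finite_verts)
    show "i \<in> pverts G1 \<and> j \<in> pverts G1" if "?E i j" for i j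
      using G.wellformed'[OF that] by simp
    show "?E j i" if "?E i j" for i j using that by (rule sym)
    show "(i, j) \<in> parcs G2 \<longleftrightarrow> ?E i j \<and> \<not> (i = w \<and> j \<in> Z) \<and> \<not> (i \<in> Z \<and> j = w) \<or>
        i = u \<and> j \<in> Z \<or> i \<in> Z \<and> j = u" for i j
      by (auto simp: G2 move_neighbours_def Let_def Z_def)
    show "u \<noteq> w" by (rule uw)
    show "u \<in> set vs" "w \<in> set vs" using set_vs vs_u vs_w by blast+
    show "set vs \<subseteq> pverts G1" using walk by (auto simp: vs_def)
    show "set vs \<inter> (R - {w}) = {}" using vs_R by blast
    show "Z \<subseteq> R - {w}" using Z_R G.no_loops' by (auto simp: Z_def)
    show "R - {w} \<subseteq> pverts G1" using G.awalk_last_in_verts by (auto simp: R_def)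
    show "?E w z" if "z \<in> Z" for z using that by (simp add: Z_def)
    show "y \<in> Z \<or> y \<in> set vs" if "?E w y" for y
      using that w'_vs by (auto simp: Z_def)
    show "y \<in> R - {w} \<or> y = w \<and> x \<in> Z" if x: "x \<in> R - {w}" and xy: "?E x y" for x y
    proof -
      have xvs: "x \<notin> set vs" using x vs_R by blast
      hence "y \<in> R" using R_step[of x y] x xy PE_vs[of x y] by blast
      moreover have "x \<noteq> fst (last P)" using xvs w'_vs by auto
      ultimately show ?thesis using sym[OF xy] by (auto simp: Z_def)
    qed
    show "y \<in> set vs" if x: "x \<in> set vs" "x \<noteq> u" "x \<noteq> w" and xy: "?E x y" for x y
    proof -
      obtain i where i: "i \<le> m" "x = vs ! i" using x(1) set_vs by blast
      hence "0 < i" "i < m" using x vs_u vs_w by (auto intro!: le_neq_implies_less gr0I)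
      thus ?thesis using inner_PE[of i y] PE_vs[of x y] xy i(2) by blast
    qed
    show "rho permutes set vs" by (rule rho(1))
    show "rho (rho x) = x" for x by (rule rho(2))
    show "rho u = w" using rho(3)[of 0] vs_u vs_w by simp
    show "?E (rho x) (rho y)" if xy: "x \<in> set vs" "y \<in> set vs" "?E x y" for x y
    proof -
      obtain i j where ij: "i \<le> m" "x = vs ! i" "j \<le> m" "y = vs ! j" using xy set_vs by blast
      have r: "rho x = vs ! (m - i)" "rho y = vs ! (m - j)" using ij rho(3) by auto
      from ij xy(3) have "i = Suc j \<or> j = Suc i" using path_nb by blast
      thus ?thesis
      proof
        assume "i = Suc j"
        thus ?thesis using step(1)[of "m - i"] ij(1) r by (simp add: Suc_diff_Suc)
      next
        assume "j = Suc i"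
        thus ?thesis using step(2)[of "m - j"] ij(3) r by (simp add: Suc_diff_Suc)
      qed
    qed
  qed
  thus ?thesis by blast
qed

section \<open>Nonnegativity, integrality and monotonicity of the coefficients\<close>

lemma sum_cycle_choices_irr_char_nonneg:
  assumes "sum_list lam = n"
  shows "(\<Sum>p\<in>cycle_choices {0..<n} f. irr_char lam p) \<ge> 0"
  using irr_char_conjugate[of _ lam] irr_char_positive_definite[of _ lam] assms
  by (intro sum_cycle_choices_nonneg) auto

lemma sum_cycle_choices_irr_char_Ints:
  assumes "sum_list lam = n"
  shows "(\<Sum>p\<in>cycle_choices {0..<n} f. irr_char lam p) \<in> \<int>"
  using irr_char_Ints[of _ lam] assms by (intro Ints_sum) (auto simp: cycle_choices_def)

lemma Nats_if_Ints_nonneg: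
  fixes z :: complex
  assumes "z \<in> \<int>" "z \<ge> 0"
  shows "z \<in> \<nat>"
proof -
  obtain k where k: "z = of_int k" using assms(1) by (elim Ints_cases)
  hence "k \<ge> 0" using assms(2) by (simp add: less_eq_complex_def)
  thus ?thesis unfolding k by (metis nonneg_int_cases of_int_of_nat_eq of_nat_in_Nats)
qed

lemma imm_coeff_bipartite:
  assumes "connected_bipartite_graph n G" "r \<le> n"
  shows "imm_coeff lam (laplacian n G) r =
    (\<Sum>f | f \<in> orientations (\<lambda>i j. (i, j) \<in> parcs G) \<and> card (moved f) = r.
       \<Sum>p\<in>cycle_choices {0..<n} f. irr_char lam p)"
proof -
  interpret G: pair_graph G using assms(1) by (simp add: connected_bipartite_graph_def)
  obtain X where "\<forall>(i, j)\<in>parcs G. i \<in> X \<longleftrightarrow> j \<notin> X"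
    using assms(1) by (auto simp: connected_bipartite_graph_def bipartite_def)
  moreover have "i < n \<and> j < n" if "(i, j) \<in> parcs G" for i j
    using G.wellformed'[OF that] assms(1) by (simp add: connected_bipartite_graph_def)
  ultimately show ?thesis using assms(2) by (intro imm_coeff_laplacian[of G n X]) auto
qed

theorem theorem2:
  "(\<forall>n G lam r.
      connected_bipartite_graph n G \<and> partition_of lam n \<and> r \<le> n \<longrightarrow>
      imm_coeff lam (laplacian n G) r \<in> \<nat>) \<and>
   (\<forall>n G1 G2 lam r.
      connected_bipartite_graph n G1 \<and> connected_bipartite_graph n G2 \<and> ggs G1 G2 \<and>
      partition_of lam n \<and> r \<le> n \<longrightarrow>
      imm_coeff lam (laplacian n G2) r \<le> imm_coeff lam (laplacian n G1) r)"
proof (intro conjI allI impI; elim conjE)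
  fix n G lam r
  assume G: "connected_bipartite_graph n G" "r \<le> n" and lam: "partition_of lam n"
  have "sum_list lam = n" using lam by (simp add: partition_of_def)
  thus "imm_coeff lam (laplacian n G) r \<in> \<nat>"
    unfolding imm_coeff_bipartite[OF G]
    by (intro Nats_if_Ints_nonneg Ints_sum sum_nonneg
        sum_cycle_choices_irr_char_Ints sum_cycle_choices_irr_char_nonneg)
next
  fix n G1 G2 lam r
  assume G1: "connected_bipartite_graph n G1" and G2: "connected_bipartite_graph n G2"
    and shift: "ggs G1 G2" and lam: "partition_of lam n" and r: "r \<le> n"
  have n: "sum_list lam = n" using lam by (simp add: partition_of_def)
  have "pair_graph G1" and V: "pverts G1 = {0..<n}"
    using G1 by (simp_all add: connected_bipartite_graph_def)
  then obtain u w Q B Z rho where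
    "path_shift {0..<n} (\<lambda>i j. (i, j) \<in> parcs G1) (\<lambda>i j. (i, j) \<in> parcs G2) u w Q B Z rho"
    using ggs_path_shift[OF _ shift] by metis
  then interpret path_shift "{0..<n}" "\<lambda>i j. (i, j) \<in> parcs G1" "\<lambda>i j. (i, j) \<in> parcs G2"
    u w Q B Z rho .
  show "imm_coeff lam (laplacian n G2) r \<le> imm_coeff lam (laplacian n G1) r"
    unfolding imm_coeff_bipartite[OF G1 r] imm_coeff_bipartite[OF G2 r]
  proof (rule sum_orientations_le)
    show "irr_char lam (t \<circ> g \<circ> inv t) = irr_char lam g"
      if "g permutes {0..<n}" "t permutes {0..<n}" for g t
      using irr_char_conjugate[of g lam t] that n by simp
  qed (rule sum_cycle_choices_irr_char_nonneg[OF n])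
qed

end
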